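(* Let $H$ be a graph. For every $\varepsilon>0$ there exists $C>0$ such that the following holds. If $p=p(n)\geq Cn^{-1/\max\{m_2(H),1\}}$ and $G\sim\mathbb{G}(n,p)$, then with high probability $G$ is $(H,\varepsilon n)$-rich.
   Context: $\mathbb{G}(n,p)$ is the binomial random graph on $n$ vertices with edge probability $p$; "with high probability" means with probability tending to $1$ as $n\to\infty$. For a graph $H$ with at least two edges, $m_2(H)=\max\{(e(F)-1)/(v(F)-2) : F\subseteq H,\ v(F)\ge 3\}$; otherwise $m_2(H)=1/2$. $\alpha(H)$ is the independence number of $H$. A copy of $H$ is a subgraph isomorphic to $H$; it is red (blue) if all its edges are red (blue). For $s>0$, a graph $G$ is $(H,s)$-rich if for every $2$-colouring (red/blue) of the edges of $G$ and every pair of disjoint sets $X,Y\subset V(G)$ with $|X|=|Y|=s$, at least one of the following holds: (i) there is a red copy $H'$ of $H$ in $G[X\cup Y]$ with $|V(H')\cap X|\ge\alpha(H)$; (ii) there is a blue copy $H'$ of $H$ in $G[X\cup Y]$ with $|V(H')\cap Y|\ge \alpha(H)$. *)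

theory Defs
  imports "HOL-Probability.Probability"
begin

section \<open>Finite simple graphs\<close>

text \<open>A graph is a pair of a vertex set and a set of edges, each edge being a two-element set
  of vertices.\<close>

type_synonym 'a graph = "'a set \<times> 'a set set"

abbreviation verts :: "'a graph \<Rightarrow> 'a set" where
  "verts \<equiv> fst"

abbreviation edges :: "'a graph \<Rightarrow> 'a set set" where
  "edges \<equiv> snd"

definition simple_graph :: "'a graph \<Rightarrow> bool" where
  "simple_graph G \<longleftrightarrow> finite (verts G) \<and> (\<forall>e\<in>edges G. e \<subseteq> verts G \<and> card e = 2)"

definition subgraph :: "'a graph \<Rightarrow> 'a graph \<Rightarrow> bool" where
  "subgraph F G \<longleftrightarrow> simple_graph F \<and> verts F \<subseteq> verts G \<and> edges F \<subseteq> edges G"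

definition induced_subgraph :: "'a graph \<Rightarrow> 'a set \<Rightarrow> 'a graph" where
  "induced_subgraph G U = (verts G \<inter> U, {e \<in> edges G. e \<subseteq> U})"

definition graph_isomorphic :: "'a graph \<Rightarrow> 'b graph \<Rightarrow> bool" where
  "graph_isomorphic G G' \<longleftrightarrow>
     (\<exists>f. bij_betw f (verts G) (verts G') \<and> edges G' = (\<lambda>e. f ` e) ` edges G)"

definition is_copy_in :: "'b graph \<Rightarrow> 'a graph \<Rightarrow> 'b graph \<Rightarrow> bool" where
  "is_copy_in H' H G \<longleftrightarrow> subgraph H' G \<and> graph_isomorphic H H'"

definition independent_set :: "'a graph \<Rightarrow> 'a set \<Rightarrow> bool" where
  "independent_set G S \<longleftrightarrow> S \<subseteq> verts G \<and> (\<forall>e\<in>edges G. \<not> e \<subseteq> S)"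

definition independence_number :: "'a graph \<Rightarrow> nat" where
  "independence_number G = Max {card S | S. independent_set G S}"

definition m2_density :: "'a graph \<Rightarrow> real" where
  "m2_density H =
     (if card (edges H) \<ge> 2
      then Max {(real (card (edges F)) - 1) / (real (card (verts F)) - 2) | F.
                  subgraph F H \<and> card (verts F) \<ge> 3}
      else 1 / 2)"


section \<open>Rich graphs\<close>

datatype colour = Red | Blue

definition monochromatic :: "('a set \<Rightarrow> colour) \<Rightarrow> colour \<Rightarrow> 'a graph \<Rightarrow> bool" where
  "monochromatic \<phi> c G \<longleftrightarrow> (\<forall>e\<in>edges G. \<phi> e = c)"

text \<open>A 2-colouring of the edges is given by a total function; its values off the edge set
  of \<open>G\<close> play no role.\<close>

definition rich :: "'a graph \<Rightarrow> nat \<Rightarrow> 'b graph \<Rightarrow> bool" where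
  "rich H s G \<longleftrightarrow>
     (\<forall>\<phi> X Y. X \<subseteq> verts G \<and> Y \<subseteq> verts G \<and> X \<inter> Y = {} \<and> card X = s \<and> card Y = s \<longrightarrow>
        (\<exists>H'. is_copy_in H' H (induced_subgraph G (X \<union> Y)) \<and> monochromatic \<phi> Red H' \<and>
              card (verts H' \<inter> X) \<ge> independence_number H) \<or>
        (\<exists>H'. is_copy_in H' H (induced_subgraph G (X \<union> Y)) \<and> monochromatic \<phi> Blue H' \<and>
              card (verts H' \<inter> Y) \<ge> independence_number H))"


section \<open>The binomial random graph\<close>

definition vertex_pairs :: "nat \<Rightarrow> nat set set" where
  "vertex_pairs n = {e. e \<subseteq> {..<n} \<and> card e = 2}"

text \<open>One independent Bernoulli trial per pair of vertices; for \<open>p\<close> outside \<open>[0,1]\<close> the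
  library's \<^const>\<open>bernoulli_pmf\<close> clamps \<open>p\<close> to that interval.\<close>

definition binomial_random_graph :: "nat \<Rightarrow> real \<Rightarrow> nat graph pmf" where
  "binomial_random_graph n p =
     map_pmf (\<lambda>f. ({..<n}, {e \<in> vertex_pairs n. f e}))
       (Pi_pmf (vertex_pairs n) False (\<lambda>_. bernoulli_pmf p))"

end

theory Submission
  imports Defs "HOL-Library.Ramsey"
begin

text \<open>Write \<open>m = max (m\<^sub>2(H)) 1\<close> and \<open>t = n powr (-1/m)\<close>. If \<open>G\<close> is not rich, witnessed by a colouring and
  sets \<open>X\<close>, \<open>Y\<close>, then the coloured edges of \<open>G\<close> inside \<open>X \<union> Y\<close> form an independent set in the
  hypergraph whose hyperedges are the red copies of \<open>H\<close> with at least \<open>\<alpha>(H)\<close> vertices in \<open>X\<close>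
  and the blue copies with at least \<open>\<alpha>(H)\<close> vertices in \<open>Y\<close>. By Ramsey's theorem, any colouring
  of almost all pairs in \<open>X \<union> Y\<close> contains a positive proportion of these copies: in a large enough pattern either
  \<open>X\<close> contains a red clique, or \<open>Y\<close> a blue clique, or there are a blue clique in \<open>X\<close> and a red
  clique in \<open>Y\<close> joined monochromatically, and then a maximum independent set of \<open>H\<close> goes to one
  side and the rest of \<open>H\<close> to the other. Hence hypergraph containers apply: each independent
  set has a fingerprint of size \<open>O(n\<^sup>2 t)\<close> that determines a container missing \<open>\<Omega>(n\<^sup>2)\<close>
  pairs in both colours. A union bound over \<open>X\<close>, \<open>Y\<close> and the fingerprints finishes the proof: the
  graph has to contain the fingerprint and avoid the missed pairs.

  The container lemma follows the approach of Nenadov and Pham. One repeatedly takes the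
  vertex of largest degree of the independent set and collects its links into a hypergraph of
  uniformity one less, never letting a set exceed its allowed degree. Either the collected
  hypergraph becomes heavy, and one recurses into it, or all remaining vertices of the independent
  set have low degree, so that the high-degree vertices are excluded.\<close>

section \<open>Fingerprints\<close>

text \<open>A fingerprint \<open>F I\<close> determines the result \<open>Z I\<close> because \<open>Z (F I) = Z I\<close>; the condition on all
  intermediate sets makes this notion stable under composition of algorithms.\<close>

definition determined :: "('v set \<Rightarrow> 'v set) \<Rightarrow> ('v set \<Rightarrow> 'z) \<Rightarrow> 'v set \<Rightarrow> bool" where
  "determined F Z I \<longleftrightarrow> (\<forall>I'. F I \<subseteq> I' \<longrightarrow> I' \<subseteq> I \<longrightarrow> F I' = F I \<and> Z I' = Z I)"

lemma determinedD:
  assumes "determined F Z I" "F I \<subseteq> I'" "I' \<subseteq> I"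
  shows "F I' = F I" "Z I' = Z I"
  using assms unfolding determined_def by blast+

text \<open>One phase of a container algorithm seen from outside: \<open>J\<close> is the class of
  inputs, \<open>q\<close> bounds the fingerprint and \<open>P\<close> relates input and result.
  \<open>F\<close> and \<open>Z\<close> are fixed before \<open>I\<close>, so there are no more
  results than fingerprints.\<close>

definition fingerprinted :: "'v set set \<Rightarrow> real \<Rightarrow> ('v set \<Rightarrow> 'z \<Rightarrow> bool) \<Rightarrow> bool" where
  "fingerprinted J q P \<longleftrightarrow>
     (\<exists>F Z. \<forall>I\<in>J. F I \<subseteq> I \<and> real (card (F I)) \<le> q \<and> P I (Z I) \<and> determined F Z I)"

lemma fingerprinted_return:
  assumes "0 \<le> q" "\<And>I. I \<in> J \<Longrightarrow> P I z"
  shows "fingerprinted J q P"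
  unfolding fingerprinted_def determined_def
  by (rule exI[of _ "\<lambda>_. {}"], rule exI[of _ "\<lambda>_. z"]) (use assms in auto)

lemma fingerprinted_mono:
  assumes "fingerprinted J q P" "q \<le> q'" "J' \<subseteq> J" "\<And>I z. I \<in> J' \<Longrightarrow> P I z \<Longrightarrow> P' I z"
  shows "fingerprinted J' q' P'"
proof -
  from assms(1) obtain F Z where FZ: "\<forall>I\<in>J. F I \<subseteq> I \<and> real (card (F I)) \<le> q \<and> P I (Z I) \<and> determined F Z I"
    unfolding fingerprinted_def by blast
  have "\<forall>I\<in>J'. F I \<subseteq> I \<and> real (card (F I)) \<le> q' \<and> P' I (Z I) \<and> determined F Z I"
    using FZ assms(2-4) by fastforce
  then show ?thesis
    unfolding fingerprinted_def by blast
qed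

text \<open>Phases run one after the other, and the second may depend on the output \<open>z\<close>
  of the first. A set between the joint fingerprint and \<open>I\<close> contains
  \<open>F I\<close>, hence produces the same \<open>z\<close> and starts the same second phase,
  whose fingerprint it contains as well.\<close>

lemma fingerprinted_bind:
  assumes 1: "fingerprinted J q1 P" and 2: "\<And>z. fingerprinted {I \<in> J. P I z} q2 Q"
  shows "fingerprinted J (q1 + q2) Q"
proof -
  from 1 obtain F Z where FZ: "\<And>I. I \<in> J \<Longrightarrow> F I \<subseteq> I \<and> real (card (F I)) \<le> q1 \<and> P I (Z I) \<and> determined F Z I"
    unfolding fingerprinted_def by blast
  from 2 have "\<forall>z. \<exists>F Z. \<forall>I\<in>{I \<in> J. P I z}. F I \<subseteq> I \<and> real (card (F I)) \<le> q2 \<and> Q I (Z I) \<and> determined F Z I"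
    unfolding fingerprinted_def by blast
  then obtain F2 Z2 where FZ2: "\<And>z I. I \<in> J \<Longrightarrow> P I z \<Longrightarrow>
        F2 z I \<subseteq> I \<and> real (card (F2 z I)) \<le> q2 \<and> Q I (Z2 z I) \<and> determined (F2 z) (Z2 z) I"
    by (metis (no_types, lifting) mem_Collect_eq)
  let ?F = "\<lambda>I. F I \<union> F2 (Z I) I" and ?Z = "\<lambda>I. Z2 (Z I) I"
  have "?F I \<subseteq> I \<and> real (card (?F I)) \<le> q1 + q2 \<and> Q I (?Z I) \<and> determined ?F ?Z I" if I: "I \<in> J" for I
  proof -
    have a: "F I \<subseteq> I" "real (card (F I)) \<le> q1" "P I (Z I)" "determined F Z I"
      using FZ[OF I] by auto
    have b: "F2 (Z I) I \<subseteq> I" "real (card (F2 (Z I) I)) \<le> q2" "Q I (Z2 (Z I) I)"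
       "determined (F2 (Z I)) (Z2 (Z I)) I"
      using FZ2[OF I a(3)] by auto
    have "real (card (?F I)) \<le> real (card (F I)) + real (card (F2 (Z I) I))"
      by (metis card_Un_le of_nat_add of_nat_le_iff)
    also have "\<dots> \<le> q1 + q2" using a b by (intro add_mono)
    finally have c: "real (card (?F I)) \<le> q1 + q2" .
    have "?F I' = ?F I \<and> ?Z I' = ?Z I" if sub: "?F I \<subseteq> I'" "I' \<subseteq> I" for I'
    proof -
      have "Z I' = Z I" "F I' = F I"
        using determinedD[OF a(4)] sub by simp_all
      moreover have "F2 (Z I) I' = F2 (Z I) I" "Z2 (Z I) I' = Z2 (Z I) I"
        using determinedD[OF b(4)] sub by simp_all
      ultimately show ?thesis by simp
    qed
    then have "determined ?F ?Z I" unfolding determined_def by blast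
    with a b c show ?thesis by blast
  qed
  then show ?thesis
    unfolding fingerprinted_def by (intro exI[of _ ?F] exI[of _ ?Z]) blast
qed

text \<open>The greedy choice: the picked vertex is itself the fingerprint. The choice has to
  survive passing to a smaller set that still contains it, which a fixed tie-breaking rule
  guarantees.\<close>

lemma fingerprinted_pick:
  fixes g :: "'v \<Rightarrow> real"
  assumes fin: "finite V" and J: "\<And>I. I \<in> J \<Longrightarrow> I \<subseteq> V"
  shows "fingerprinted J 1 (\<lambda>I z. case z of None \<Rightarrow> I \<subseteq> S
           | Some v \<Rightarrow> v \<in> I - S \<and> (\<forall>u\<in>I - S. g u \<le> g v))"
proof -
  obtain idx :: "'v \<Rightarrow> nat" where idx: "inj_on idx V"
    using finite_imp_inj_to_nat_seg[OF fin] by blast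
  \<comment> \<open>Lexicographic maximality in \<open>(g, idx)\<close>; injectivity of
    \<open>idx\<close> on \<open>V\<close> leaves at most one best vertex.\<close>
  define best where "best = (\<lambda>I v. v \<in> I - S \<and> (\<forall>u\<in>I - S. g u < g v \<or> (g u = g v \<and> idx u \<le> idx v)))"
  have unique: "u = v" if "best I u" "best I v" "I \<subseteq> V" for I u v
  proof -
    have "idx u = idx v" using that unfolding best_def by (metis less_irrefl less_trans order_antisym)
    then show ?thesis using idx that unfolding best_def inj_on_def by blast
  qed
  have ex: "\<exists>v. best I v" if I: "I \<subseteq> V" and ne: "\<not> I \<subseteq> S" for I
  proof -
    have finI: "finite (I - S)" using fin I finite_subset by blast
    have "Max (g ` (I - S)) \<in> g ` (I - S)" using finI ne by (intro Max_in) auto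
    then obtain m where m: "m \<in> I - S" "g m = Max (g ` (I - S))" by auto
    have gm: "g u \<le> g m" if "u \<in> I - S" for u using finI that m(2) by simp
    define L where "L = {u \<in> I - S. g u = g m}"
    have "L \<subseteq> I - S" unfolding L_def by blast
    then have finL: "finite L" using finI finite_subset by blast
    have neL: "L \<noteq> {}" using m unfolding L_def by blast
    have "Max (idx ` L) \<in> idx ` L" using finL neL by (intro Max_in) auto
    then obtain v where v: "v \<in> L" "idx v = Max (idx ` L)" by auto
    have iv: "idx u \<le> idx v" if "u \<in> L" for u using finL that v(2) by simp
    have "best I v" unfolding best_def
    proof (intro conjI ballI)
      show "v \<in> I - S" using v L_def by auto
      fix u assume u: "u \<in> I - S"
      show "g u < g v \<or> (g u = g v \<and> idx u \<le> idx v)"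
        using gm[OF u] iv[of u] v(1) u unfolding L_def by auto
    qed
    then show ?thesis by blast
  qed
  define b where "b = (\<lambda>I. SOME v. best I v)"
  have b: "best I (b I)" if "I \<subseteq> V" "\<not> I \<subseteq> S" for I
    unfolding b_def using ex[OF that] by (rule someI_ex)
  let ?F = "\<lambda>I. if I \<subseteq> S then {} else {b I}" and ?Z = "\<lambda>I. if I \<subseteq> S then None else Some (b I)"
  have "?F I \<subseteq> I \<and> real (card (?F I)) \<le> 1 \<and> (case ?Z I of None \<Rightarrow> I \<subseteq> S
           | Some v \<Rightarrow> v \<in> I - S \<and> (\<forall>u\<in>I - S. g u \<le> g v)) \<and> determined ?F ?Z I" if "I \<in> J" for I
  proof (cases "I \<subseteq> S")
    case True
    then show ?thesis unfolding determined_def by auto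
  next
    case False
    have IV: "I \<subseteq> V" using J that by blast
    note bI = b[OF IV False]
    \<comment> \<open>A maximum over \<open>I - S\<close> stays the maximum over every smaller set
      that contains it.\<close>
    have cons: "\<not> I' \<subseteq> S \<and> b I' = b I" if "b I \<in> I'" "I' \<subseteq> I" for I'
    proof -
      have n: "\<not> I' \<subseteq> S" using bI that unfolding best_def by auto
      have V': "I' \<subseteq> V" using that IV by blast
      have "best I' (b I)" using bI that unfolding best_def by auto
      then have "b I' = b I" using unique[OF b[OF V' n] _ V'] by blast
      then show ?thesis using n by simp
    qed
    have d: "determined ?F ?Z I" unfolding determined_def using cons False by simp
    have e: "b I \<in> I - S" using bI unfolding best_def by blast
    have e': "\<forall>u\<in>I - S. g u \<le> g (b I)"
    proof
      fix u assume "u \<in> I - S"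
      then have "g u < g (b I) \<or> g u = g (b I)" using bI unfolding best_def by blast
      then show "g u \<le> g (b I)" by linarith
    qed
    have f: "?F I = {b I}" "?Z I = Some (b I)" using False by auto
    show ?thesis
    proof (intro conjI)
      show "?F I \<subseteq> I" "real (card (?F I)) \<le> 1" unfolding f using e by auto
      show "case ?Z I of None \<Rightarrow> I \<subseteq> S | Some v \<Rightarrow> v \<in> I - S \<and> (\<forall>u\<in>I - S. g u \<le> g v)"
        unfolding f using e e' by simp
      show "determined ?F ?Z I" by (rule d)
    qed
  qed
  then show ?thesis
    unfolding fingerprinted_def by (intro exI[of _ ?F] exI[of _ ?Z]) blast
qed

section \<open>Weighted hypergraphs: degrees, links and saturation\<close>

definition wdeg :: "'v set \<Rightarrow> ('v set \<Rightarrow> real) \<Rightarrow> 'v set \<Rightarrow> real" where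
  "wdeg V w T = (\<Sum>A | A \<subseteq> V \<and> T \<subseteq> A. w A)"

text \<open>\<open>w\<close> is a weighted \<open>l\<close>-uniform hypergraph on \<open>V\<close>; the degree condition is the usual one for
  containers with fingerprints of density \<open>t\<close>.\<close>

definition spread :: "'v set \<Rightarrow> real \<Rightarrow> real \<Rightarrow> real \<Rightarrow> nat \<Rightarrow> ('v set \<Rightarrow> real) \<Rightarrow> bool" where
  "spread V N t K l w \<longleftrightarrow>
     (\<forall>A. 0 \<le> w A) \<and> (\<forall>A. w A \<noteq> 0 \<longrightarrow> A \<subseteq> V \<and> card A = l) \<and>
     (\<forall>T. T \<subseteq> V \<longrightarrow> T \<noteq> {} \<longrightarrow> wdeg V w T \<le> K * t ^ (card T - 1) / N)"

definition edge_free :: "('v set \<Rightarrow> real) \<Rightarrow> 'v set \<Rightarrow> bool" where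
  "edge_free w I \<longleftrightarrow> (\<forall>A. w A \<noteq> 0 \<longrightarrow> \<not> A \<subseteq> I)"

text \<open>The guard matters: for \<open>v\<close> in \<open>A\<close> the set
  \<open>insert v A\<close> is \<open>A\<close> itself, so an edge through \<open>v\<close> would
  reappear in its own link and the uniformity would not drop.\<close>

definition link :: "'v \<Rightarrow> ('v set \<Rightarrow> real) \<Rightarrow> 'v set \<Rightarrow> real" where
  "link v r A = (if v \<notin> A then r (insert v A) else 0)"

text \<open>A set \<open>T\<close> is saturated when its degree in the collected hypergraph \<open>w'\<close> has reached \<open>thr T\<close>;
  hyperedges of \<open>w\<close> containing a saturated set are no longer used.\<close>

definition residual :: "'v set \<Rightarrow> ('v set \<Rightarrow> real) \<Rightarrow> ('v set \<Rightarrow> real) \<Rightarrow> ('v set \<Rightarrow> real) \<Rightarrow> 'v set \<Rightarrow> real" where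
  "residual V thr w w' A = (if \<exists>T. T \<noteq> {} \<and> T \<subseteq> A \<and> thr T \<le> wdeg V w' T then 0 else w A)"

lemma wdeg_mono: "(\<And>A. w A \<le> w' A) \<Longrightarrow> wdeg V w T \<le> wdeg V w' T"
  unfolding wdeg_def by (rule sum_mono) auto

lemma wdeg_nonneg: "(\<And>A. 0 \<le> w A) \<Longrightarrow> 0 \<le> wdeg V w T"
  unfolding wdeg_def by (rule sum_nonneg) auto

lemma wdeg_add: "wdeg V (\<lambda>A. w A + w' A) T = wdeg V w T + wdeg V w' T"
  unfolding wdeg_def by (rule sum.distrib)

lemma wdeg_link:
  assumes "finite V" "v \<in> V" "v \<notin> T"
  shows "wdeg V (link v r) T = wdeg V r (insert v T)"
proof -
  have "wdeg V r (insert v T) = (\<Sum>A | A \<subseteq> V - {v} \<and> T \<subseteq> A. r (insert v A))"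
    unfolding wdeg_def
    by (rule sum.reindex_bij_witness[of _ "insert v" "\<lambda>A. A - {v}"]) (use assms in \<open>auto simp: insert_absorb\<close>)
  also have "\<dots> = (\<Sum>A | A \<subseteq> V \<and> T \<subseteq> A. link v r A)"
    by (rule sum.mono_neutral_cong_left) (use assms in \<open>auto simp: link_def\<close>)
  finally show ?thesis unfolding wdeg_def by simp
qed

section \<open>Containers\<close>

lemma wdeg_scale: "wdeg V (\<lambda>A. c * w A) T = c * wdeg V w T"
  unfolding wdeg_def by (rule sum_distrib_left[symmetric])

lemma spreadD:
  assumes "spread V N t K l w"
  shows spread_nonneg: "0 \<le> w A"
    and spread_support: "w A \<noteq> 0 \<Longrightarrow> A \<subseteq> V" "w A \<noteq> 0 \<Longrightarrow> card A = l"
    and spread_wdeg: "T \<subseteq> V \<Longrightarrow> T \<noteq> {} \<Longrightarrow> wdeg V w T \<le> K * t ^ (card T - 1) / N"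
  using assms unfolding spread_def by blast+

lemma residual_le: "0 \<le> w A \<Longrightarrow> residual V thr w w' A \<le> w A"
  unfolding residual_def by simp

lemma residual_nonneg: "0 \<le> w A \<Longrightarrow> 0 \<le> residual V thr w w' A"
  unfolding residual_def by simp

text \<open>Collecting more weight can only saturate more sets.\<close>

lemma residual_antimono:
  assumes "\<And>A. w' A \<le> w'' A" "0 \<le> w A"
  shows "residual V thr w w'' A \<le> residual V thr w w' A"
proof (cases "\<exists>T. T \<noteq> {} \<and> T \<subseteq> A \<and> thr T \<le> wdeg V w' T")
  case True
  then obtain T where "T \<noteq> {}" "T \<subseteq> A" "thr T \<le> wdeg V w' T" by blast
  moreover have "wdeg V w' T \<le> wdeg V w'' T" using assms(1) by (rule wdeg_mono)
  ultimately have "residual V thr w w'' A = 0" unfolding residual_def by (auto intro: order_trans)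
  then show ?thesis using assms(2) residual_nonneg by metis
next
  case False
  then have "residual V thr w w' A = w A" unfolding residual_def by auto
  then show ?thesis using residual_le assms(2) by metis
qed

text \<open>A saturated set gains nothing, since every edge containing it has left the residual. An
  unsaturated \<open>T\<close> is below its threshold, which accounts for \<open>K'\<close>, and
  gains at most the \<open>w\<close>-degree of \<open>insert v T\<close>, which accounts for
  \<open>K\<close>. That set has one more element than \<open>T\<close>, whence the extra factor
  \<open>t\<close>.\<close>

lemma spread_add_link:
  assumes fin: "finite V" and w: "spread V N t K (Suc l) w" and w': "spread V N t ((K + K') * t) l w'"
    and pos: "0 \<le> K" "0 \<le> K'" "0 < t" "0 < N" and v: "v \<in> V"
    and thr: "thr = (\<lambda>T. K' * t ^ card T / N)"
  shows "spread V N t ((K + K') * t) l (\<lambda>A. w' A + link v (residual V thr w w') A)"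
proof -
  let ?r = "residual V thr w w'"
  have w0: "0 \<le> w A" for A using spread_nonneg[OF w] by blast
  have w'0: "0 \<le> w' A" for A using spreadD[OF w'] by blast
  have l0: "0 \<le> link v ?r A" for A unfolding link_def using residual_nonneg[of w, OF w0] by simp
  show ?thesis unfolding spread_def
  proof (intro conjI allI impI)
    fix A show "0 \<le> w' A + link v ?r A" using w'0 l0 by (simp add: add_nonneg_nonneg)
  next
    fix A assume nz: "w' A + link v ?r A \<noteq> 0"
    have "A \<subseteq> V \<and> card A = l"
    proof (cases "w' A = 0")
      case False
      then show ?thesis using spreadD[OF w'] by blast
    next
      case True
      then have "v \<notin> A" "?r (insert v A) \<noteq> 0" using nz unfolding link_def by (auto split: if_splits)
      then have vA: "v \<notin> A" "w (insert v A) \<noteq> 0" unfolding residual_def by (auto split: if_splits)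
      then have a: "insert v A \<subseteq> V" "card (insert v A) = Suc l" using spread_support[OF w] by blast+
      then have "finite A" using fin finite_subset by auto
      then show ?thesis using a vA by simp
    qed
    then show "A \<subseteq> V" "card A = l" by auto
  next
    fix T assume T: "T \<subseteq> V" "T \<noteq> {}"
    have finT: "finite T" using T fin finite_subset by blast
    then have cT: "card T \<ge> 1" using T by (simp add: Suc_leI card_gt_0_iff)
    have tp: "t * t ^ (card T - 1) = t ^ card T" using cT by (cases "card T") auto
    have eq: "(K + K') * t * t ^ (card T - 1) / N = K * t ^ card T / N + K' * t ^ card T / N"
      by (simp only: mult.assoc tp) (simp add: field_simps add_divide_distrib)
    show "wdeg V (\<lambda>A. w' A + link v ?r A) T \<le> (K + K') * t * t ^ (card T - 1) / N"
    proof (cases "thr T \<le> wdeg V w' T")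
      case True
      have "link v ?r A = 0" if "T \<subseteq> A" for A
        unfolding link_def residual_def using True that T by auto
      then have "wdeg V (link v ?r) T = 0" unfolding wdeg_def by (intro sum.neutral) auto
      moreover have "wdeg V w' T \<le> (K + K') * t * t ^ (card T - 1) / N"
        by (rule spread_wdeg[OF w' T])
      ultimately show ?thesis by (simp add: wdeg_add)
    next
      case False
      have "wdeg V (link v ?r) T \<le> K * t ^ card T / N"
      proof (cases "v \<in> T")
        case True
        then have "wdeg V (link v ?r) T = 0"
          unfolding wdeg_def by (intro sum.neutral) (auto simp: link_def)
        then show ?thesis using pos by simp
      next
        case False
        have "wdeg V (link v ?r) T = wdeg V ?r (insert v T)" by (rule wdeg_link[OF fin v False])
        also have "\<dots> \<le> wdeg V w (insert v T)" by (rule wdeg_mono) (rule residual_le, rule w0)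
        also have "\<dots> \<le> K * t ^ (card (insert v T) - 1) / N"
          using T v by (intro spread_wdeg[OF w]) auto
        also have "card (insert v T) - 1 = card T" using False finT by simp
        finally show ?thesis .
      qed
      then show ?thesis using False unfolding thr wdeg_add eq by linarith
    qed
  qed
qed

text \<open>The last invariant says that a remaining vertex has at most the average of the degrees collected
  so far, since each step takes a vertex of maximal degree and residual degrees only decrease.\<close>

lemma accumulate_links:
  fixes V :: "'v set"
  assumes fin: "finite V" and w: "spread V N t K (Suc l) w"
    and pos: "0 \<le> K" "0 \<le> K'" "0 < t" "0 < N"
    and thr: "thr = (\<lambda>T. K' * t ^ card T / N)"
  shows "fingerprinted {I. I \<subseteq> V \<and> edge_free w I} (real k)
    (\<lambda>I (S, w'). S \<subseteq> I \<and> card S \<le> k \<and> spread V N t ((K + K') * t) l w' \<and> edge_free w' I \<and>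
       (\<forall>u\<in>I - S. real k * wdeg V (residual V thr w w') {u} \<le> wdeg V w' {}))"
    (is "fingerprinted ?J _ (?P k)")
proof (induction k)
  case 0
  have "spread V N t ((K + K') * t) l (\<lambda>_. 0)"
    using pos unfolding spread_def wdeg_def by auto
  then show ?case
    by (intro fingerprinted_return[of _ _ _ "({}, \<lambda>_. 0)"]) (auto simp: edge_free_def wdeg_def)
next
  case (Suc k)
  have w0: "0 \<le> w A" for A using spread_nonneg[OF w] by blast
  have "fingerprinted {I \<in> ?J. ?P k I z} 1 (?P (Suc k))" for z
  proof -
    obtain S w' where z: "z = (S, w')" by (cases z)
    let ?r = "residual V thr w w'"
    let ?J' = "{I \<in> ?J. ?P k I z}"
    have pick: "fingerprinted ?J' 1 (\<lambda>I z. case z of None \<Rightarrow> I \<subseteq> S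
           | Some v \<Rightarrow> v \<in> I - S \<and> (\<forall>u\<in>I - S. wdeg V ?r {u} \<le> wdeg V ?r {v}))"
      (is "fingerprinted _ _ ?Q")
      by (rule fingerprinted_pick[OF fin]) auto
    have "fingerprinted {I \<in> ?J'. ?Q I y} 0 (?P (Suc k))" for y
    proof (cases y)
      \<comment> \<open>Now \<open>I - S\<close> is empty, so the condition on remaining vertices is
        vacuous and the state can be kept unchanged.\<close>
      case None
      show ?thesis
        by (rule fingerprinted_return[of _ _ _ z]) (use None z in auto)
    next
      case (Some v)
      let ?w'' = "\<lambda>A. w' A + link v ?r A"
      show ?thesis
      proof (rule fingerprinted_return[of _ _ _ "(insert v S, ?w'')"])
        fix I assume "I \<in> {I \<in> ?J'. ?Q I y}"
        then have I: "I \<subseteq> V" "edge_free w I" "S \<subseteq> I" "card S \<le> k" "spread V N t ((K + K') * t) l w'"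
          "edge_free w' I" "\<And>u. u \<in> I - S \<Longrightarrow> real k * wdeg V ?r {u} \<le> wdeg V w' {}"
          "v \<in> I - S" "\<And>u. u \<in> I - S \<Longrightarrow> wdeg V ?r {u} \<le> wdeg V ?r {v}"
          using z Some by auto
        have vV: "v \<in> V" using I by blast
        have w'0: "0 \<le> w' A" for A using spread_nonneg[OF I(5)] by blast
        have l0: "0 \<le> link v ?r A" for A unfolding link_def using residual_nonneg[of w, OF w0] by simp
        have "card (insert v S) \<le> Suc k" using I(4) card_insert_le_m1[of "Suc k" S v] by simp
        moreover have "spread V N t ((K + K') * t) l ?w''"
          by (rule spread_add_link[OF fin w I(5) pos vV thr])
        moreover have "edge_free ?w'' I"
          unfolding edge_free_def
        proof (intro allI impI)
          fix A assume nz: "?w'' A \<noteq> 0"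
          show "\<not> A \<subseteq> I"
          proof (cases "w' A = 0")
            case False
            then show ?thesis using I(6) unfolding edge_free_def by blast
          next
            case True
            then have "?r (insert v A) \<noteq> 0" using nz unfolding link_def by (auto split: if_splits)
            then have "w (insert v A) \<noteq> 0" unfolding residual_def by (auto split: if_splits)
            then have "\<not> insert v A \<subseteq> I" using I(2) unfolding edge_free_def by blast
            then show ?thesis using I(8) by blast
          qed
        qed
        moreover have "real (Suc k) * wdeg V (residual V thr w ?w'') {u} \<le> wdeg V ?w'' {}"
          if u: "u \<in> I - insert v S" for u
        proof -
          have "wdeg V (residual V thr w ?w'') {u} \<le> wdeg V ?r {u}"
            by (rule wdeg_mono, rule residual_antimono) (use l0 w0 in auto)
          then have "real (Suc k) * wdeg V (residual V thr w ?w'') {u} \<le> real (Suc k) * wdeg V ?r {u}"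
            by (intro mult_left_mono) auto
          also have "\<dots> = real k * wdeg V ?r {u} + wdeg V ?r {u}" by (simp add: algebra_simps)
          \<comment> \<open>The earlier steps pay for \<open>k\<close> copies of the degree of
            \<open>u\<close>. The last copy is at most the degree of \<open>v\<close>, which is
            exactly the weight added by the link of \<open>v\<close>.\<close>
          also have "\<dots> \<le> wdeg V w' {} + wdeg V ?r {v}" using I(7)[of u] I(9)[of u] u by (intro add_mono) auto
          also have "wdeg V ?r {v} = wdeg V (link v ?r) {}" using wdeg_link[OF fin vV, of "{}" ?r] by simp
          finally show ?thesis by (simp add: wdeg_add)
        qed
        ultimately show "?P (Suc k) I (insert v S, ?w'')" using I by auto
      qed simp
    qed
    then have "fingerprinted ?J' (1 + 0) (?P (Suc k))" using fingerprinted_bind[OF pick] by blast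
    then show ?thesis by simp
  qed
  then have "fingerprinted ?J (real k + 1) (?P (Suc k))" using fingerprinted_bind[OF Suc.IH] by blast
  then show ?case by (simp add: add.commute)
qed

section \<open>Degree counting for the case in which the collected links stay light\<close>

lemma sum_wdeg:
  assumes "finite V" "\<T> \<subseteq> Pow V"
  shows "(\<Sum>T\<in>\<T>. wdeg V w T) = (\<Sum>A | A \<subseteq> V. w A * real (card {T \<in> \<T>. T \<subseteq> A}))"
proof -
  have f: "finite \<T>" using assms finite_subset by blast
  have "(\<Sum>T\<in>\<T>. wdeg V w T) = (\<Sum>T\<in>\<T>. \<Sum>A\<in>{A \<in> Pow V. T \<subseteq> A}. w A)"
    unfolding wdeg_def by simp
  also have "\<dots> = (\<Sum>A\<in>Pow V. \<Sum>T\<in>{T \<in> \<T>. T \<subseteq> A}. w A)"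
    using f assms(1) by (intro sum.swap_restrict) auto
  also have "\<dots> = (\<Sum>A | A \<subseteq> V. w A * real (card {T \<in> \<T>. T \<subseteq> A}))"
    by (intro sum.cong) (auto simp: mult.commute)
  finally show ?thesis .
qed

lemma wdeg_empty: "wdeg V w {} = (\<Sum>A | A \<subseteq> V. w A)"
  unfolding wdeg_def by simp

text \<open>Every edge lost to the residual contains a saturated set, so the loss is at most the sum
  of the \<open>w\<close>-degrees of saturated sets. By the choice of \<open>thr\<close>, each of
  these is at most the \<open>w'\<close>-degree divided by \<open>2 ^ l * t\<close>. An edge of
  \<open>w'\<close> has only \<open>2 ^ l\<close> subsets, so the sum is at most the total weight of
  \<open>w'\<close> divided by \<open>t\<close>.\<close>

lemma wdeg_residual_ge:
  assumes fin: "finite V" and w: "spread V N t K m w" and w': "spread V N t K'' l w'"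
    and pos: "0 < K" "0 < t" "0 < N"
    and thr: "thr = (\<lambda>T. K * 2 ^ l * t ^ card T / N)"
  shows "wdeg V w {} - wdeg V w' {} / t \<le> wdeg V (residual V thr w w') {}"
proof -
  let ?r = "residual V thr w w'"
  define Sat where "Sat = {T. T \<subseteq> V \<and> T \<noteq> {} \<and> thr T \<le> wdeg V w' T}"
  have SatV: "Sat \<subseteq> Pow V" unfolding Sat_def by blast
  have finSat: "finite Sat" using SatV fin finite_subset by blast
  have "wdeg V w {} \<le> (\<Sum>A | A \<subseteq> V. ?r A + w A * real (card {T \<in> Sat. T \<subseteq> A}))"
    unfolding wdeg_empty
  proof (rule sum_mono)
    fix A assume A: "A \<in> {A. A \<subseteq> V}"
    have w0: "0 \<le> w A" by (rule spread_nonneg[OF w])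
    show "w A \<le> ?r A + w A * real (card {T \<in> Sat. T \<subseteq> A})"
    proof (cases "\<exists>T. T \<noteq> {} \<and> T \<subseteq> A \<and> thr T \<le> wdeg V w' T")
      case True
      then obtain T where "T \<in> {T \<in> Sat. T \<subseteq> A}" using A unfolding Sat_def by blast
      then have "card {T \<in> Sat. T \<subseteq> A} > 0" using finSat card_gt_0_iff by fastforce
      then have "1 \<le> real (card {T \<in> Sat. T \<subseteq> A})" by simp
      then have "w A * 1 \<le> w A * real (card {T \<in> Sat. T \<subseteq> A})" using w0 by (rule mult_left_mono)
      then show ?thesis using residual_nonneg[of w A V thr w', OF w0] by simp
    next
      case False
      then have "?r A = w A" unfolding residual_def by auto
      then show ?thesis using w0 by simp
    qed
  qed
  also have "\<dots> = wdeg V ?r {} + (\<Sum>T\<in>Sat. wdeg V w T)"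
    unfolding sum_wdeg[OF fin SatV] wdeg_empty by (rule sum.distrib)
  also have "(\<Sum>T\<in>Sat. wdeg V w T) \<le> (\<Sum>T\<in>Sat. wdeg V w' T / (2 ^ l * t))"
  proof (rule sum_mono)
    fix T assume T: "T \<in> Sat"
    then have T': "T \<subseteq> V" "T \<noteq> {}" "thr T \<le> wdeg V w' T" unfolding Sat_def by auto
    have "finite T" using T' fin finite_subset by blast
    then obtain c where c: "card T = Suc c" using T' by (cases "card T") auto
    have "wdeg V w T \<le> K * t ^ (card T - 1) / N" by (rule spread_wdeg[OF w T'(1,2)])
    also have "\<dots> = thr T / (2 ^ l * t)" unfolding thr c using pos by (simp add: field_simps)
    also have "\<dots> \<le> wdeg V w' T / (2 ^ l * t)" using T' pos by (intro divide_right_mono) auto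
    finally show "wdeg V w T \<le> wdeg V w' T / (2 ^ l * t)" .
  qed
  also have "\<dots> = (\<Sum>T\<in>Sat. wdeg V w' T) / (2 ^ l * t)" by (rule sum_divide_distrib[symmetric])
  also have "(\<Sum>T\<in>Sat. wdeg V w' T) \<le> (\<Sum>A | A \<subseteq> V. w' A * 2 ^ l)"
    unfolding sum_wdeg[OF fin SatV]
  proof (rule sum_mono)
    fix A assume A: "A \<in> {A. A \<subseteq> V}"
    have w0: "0 \<le> w' A" by (rule spread_nonneg[OF w'])
    show "w' A * real (card {T \<in> Sat. T \<subseteq> A}) \<le> w' A * 2 ^ l"
    proof (cases "w' A = 0")
      case False
      then have "card A = l" by (rule spread_support[OF w'])
      moreover have finA: "finite A" using A fin finite_subset by blast
      have "card {T \<in> Sat. T \<subseteq> A} \<le> card (Pow A)" using finA by (intro card_mono) auto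
      ultimately have "card {T \<in> Sat. T \<subseteq> A} \<le> 2 ^ l" using finA by (simp add: card_Pow)
      then have "real (card {T \<in> Sat. T \<subseteq> A}) \<le> 2 ^ l"
        by (metis of_nat_le_iff of_nat_numeral of_nat_power)
      then show ?thesis using w0 by (rule mult_left_mono)
    qed simp
  qed
  also have "\<dots> = wdeg V w' {} * 2 ^ l" unfolding wdeg_empty by (rule sum_distrib_right[symmetric])
  also have "wdeg V w' {} * 2 ^ l / (2 ^ l * t) = wdeg V w' {} / t" by simp
  finally show ?thesis using pos by (simp add: divide_right_mono)
qed

text \<open>The degrees sum to at least 3/4, as all edges are nonempty. The low-degree vertices
  contribute at most 1/4 altogether, because \<open>V\<close> has at most \<open>N\<close> elements.
  The others must supply the remaining 1/2 with at most \<open>K / N\<close> each.\<close>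

lemma card_high_degree_ge:
  assumes fin: "finite V" and cV: "real (card V) \<le> N" and pos: "0 < K" "0 < N"
    and r0: "\<And>A. 0 \<le> r A" and r1: "\<And>A. r A \<noteq> 0 \<Longrightarrow> A \<noteq> {}"
    and rK: "\<And>v. v \<in> V \<Longrightarrow> wdeg V r {v} \<le> K / N" and tot: "3 / 4 \<le> wdeg V r {}"
  shows "N / (2 * K) \<le> real (card {v \<in> V. 1 / (4 * N) < wdeg V r {v}})"
proof -
  let ?H = "{v \<in> V. 1 / (4 * N) < wdeg V r {v}}"
  let ?Sing = "(\<lambda>v. {v}) ` V"
  have "wdeg V r {} \<le> (\<Sum>A | A \<subseteq> V. r A * real (card {T \<in> ?Sing. T \<subseteq> A}))"
    unfolding wdeg_empty
  proof (rule sum_mono)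
    fix A assume A: "A \<in> {A. A \<subseteq> V}"
    show "r A \<le> r A * real (card {T \<in> ?Sing. T \<subseteq> A})"
    proof (cases "r A = 0")
      case False
      then obtain v where "v \<in> A" using r1 by blast
      then have "{v} \<in> {T \<in> ?Sing. T \<subseteq> A}" using A by auto
      then have "card {T \<in> ?Sing. T \<subseteq> A} > 0" using fin card_gt_0_iff by fastforce
      then have "1 \<le> real (card {T \<in> ?Sing. T \<subseteq> A})" by simp
      then have "r A * 1 \<le> r A * real (card {T \<in> ?Sing. T \<subseteq> A})" using r0 by (rule mult_left_mono)
      then show ?thesis by simp
    qed simp
  qed
  also have "\<dots> = (\<Sum>T\<in>?Sing. wdeg V r T)" by (rule sum_wdeg[symmetric]) (use fin in auto)
  also have "\<dots> = (\<Sum>v\<in>V. wdeg V r {v})" by (subst sum.reindex) (auto simp: inj_on_def)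
  also have "\<dots> \<le> (\<Sum>v\<in>V. (if v \<in> ?H then K / N else 0) + 1 / (4 * N))"
  proof (rule sum_mono)
    fix v assume "v \<in> V"
    moreover have "0 \<le> 1 / (4 * N)" using pos by simp
    ultimately show "wdeg V r {v} \<le> (if v \<in> ?H then K / N else 0) + 1 / (4 * N)"
      using rK[of v] by (cases "v \<in> ?H") (simp_all add: add_increasing2)
  qed
  also have "\<dots> = real (card ?H) * (K / N) + real (card V) * (1 / (4 * N))"
    using fin by (simp add: sum.distrib sum.inter_filter[symmetric])
  also have "\<dots> \<le> real (card ?H) * (K / N) + 1 / 4"
    using cV pos by (simp add: field_simps)
  finally have "1 / 2 \<le> real (card ?H) * (K / N)" using tot by simp
  then show ?thesis using pos by (simp add: field_simps)
qed

text \<open>Induction on the uniformity. About \<open>N * t\<close> greedy steps collect links. If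
  their weight reaches \<open>t / 4\<close>, the collected hypergraph is rescaled and the induction
  hypothesis applies to it. Otherwise the residual keeps weight 3/4 and has many vertices of high
  degree, none of which lies in \<open>I\<close> outside \<open>S\<close>. The constants depend on
  \<open>K\<close> and \<open>l\<close> only.\<close>

lemma container_single:
  fixes l :: nat
  assumes "0 < K"
  shows "\<exists>\<delta>>0. \<exists>A\<ge>0. \<exists>t0>0. \<forall>(V :: 'v set) N t w. finite V \<longrightarrow> real (card V) \<le> N \<longrightarrow> 0 < t \<longrightarrow> t \<le> t0 \<longrightarrow>
    1 \<le> N * t \<longrightarrow> spread V N t K l w \<longrightarrow> 1 \<le> wdeg V w {} \<longrightarrow>
    fingerprinted {I. I \<subseteq> V \<and> edge_free w I} (A * (N * t))
      (\<lambda>I C. I \<subseteq> C \<and> C \<subseteq> V \<and> real (card C) \<le> real (card V) - \<delta> * N)"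
  using assms
proof (induction l arbitrary: K)
  case 0
  \<comment> \<open>The only edge of a 0-uniform hypergraph is the empty set, which lies in every
    \<open>I\<close>. Positive weight therefore leaves no edge-free set, and the claim is
    vacuous.\<close>
  have "{I. I \<subseteq> V \<and> edge_free w I} = {}" if "spread V N t K 0 w" "1 \<le> wdeg V w {}" "finite V"
    for V :: "'v set" and N t w
  proof -
    have "w {} \<noteq> 0"
    proof
      assume e: "w {} = 0"
      have "w A = 0" if "A \<subseteq> V" for A
      proof (rule ccontr)
        assume "w A \<noteq> 0"
        then have "card A = 0" by (rule spread_support[OF \<open>spread V N t K 0 w\<close>])
        then have "A = {}" using finite_subset[OF that \<open>finite V\<close>] by simp
        then show False using e \<open>w A \<noteq> 0\<close> by simp
      qed
      then have "wdeg V w {} = 0" unfolding wdeg_def by (intro sum.neutral) auto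
      then show False using \<open>1 \<le> wdeg V w {}\<close> by simp
    qed
    then show ?thesis unfolding edge_free_def by auto
  qed
  then have "\<forall>(V :: 'v set) N t w. finite V \<longrightarrow> real (card V) \<le> N \<longrightarrow> 0 < t \<longrightarrow> t \<le> 1 \<longrightarrow>
    1 \<le> N * t \<longrightarrow> spread V N t K 0 w \<longrightarrow> 1 \<le> wdeg V w {} \<longrightarrow>
    fingerprinted {I. I \<subseteq> V \<and> edge_free w I} (1 * (N * t))
      (\<lambda>I C. I \<subseteq> C \<and> C \<subseteq> V \<and> real (card C) \<le> real (card V) - 1 * N)"
    by (intro allI impI fingerprinted_return) auto
  then show ?case by (intro exI[of _ 1] conjI) simp_all
next
  case (Suc l)
  \<comment> \<open>The factor \<open>2 ^ l\<close> is the number of subsets of a collected edge, as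
    \<open>wdeg_residual_ge\<close> demands.\<close>
  define K' where "K' = K * 2 ^ l"
  have K': "0 < K'" using Suc.prems K'_def by simp
  define K2 where "K2 = (K + K') * 4"
  have K2: "0 < K2" using Suc.prems K' K2_def by simp
  obtain \<delta>2 A2 t2 where IH: "\<delta>2 > 0" "A2 \<ge> 0" "t2 > 0" and
    IH': "\<forall>(V :: 'v set) N t w. finite V \<longrightarrow> real (card V) \<le> N \<longrightarrow> 0 < t \<longrightarrow> t \<le> t2 \<longrightarrow>
    1 \<le> N * t \<longrightarrow> spread V N t K2 l w \<longrightarrow> 1 \<le> wdeg V w {} \<longrightarrow>
    fingerprinted {I. I \<subseteq> V \<and> edge_free w I} (A2 * (N * t))
      (\<lambda>I C. I \<subseteq> C \<and> C \<subseteq> V \<and> real (card C) \<le> real (card V) - \<delta>2 * N)"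
    using Suc.IH[OF K2] by (elim exE conjE)
  \<comment> \<open>In the light case at least \<open>N / (2 * K)\<close> vertices have high degree,
    and at most \<open>2 * (N * t)\<close> of them are in \<open>S\<close>. The bound
    \<open>t \<le> 1 / (8 * K)\<close> makes the latter at most \<open>N / (4 * K)\<close>, so as
    many are removed.\<close>
  define \<delta> where "\<delta> = min \<delta>2 (1 / (4 * K))"
  define t0 where "t0 = min t2 (1 / (8 * K))"
  have \<delta>: "\<delta> > 0" "\<delta> \<le> \<delta>2" "\<delta> \<le> 1 / (4 * K)" unfolding \<delta>_def using IH Suc.prems by auto
  have t0: "t0 > 0" "t0 \<le> t2" "t0 \<le> 1 / (8 * K)" unfolding t0_def using IH Suc.prems by auto
  have main: "fingerprinted {I. I \<subseteq> V \<and> edge_free w I} ((A2 + 2) * (N * t))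
      (\<lambda>I C. I \<subseteq> C \<and> C \<subseteq> V \<and> real (card C) \<le> real (card V) - \<delta> * N)"
    if fin: "finite V" and cV: "real (card V) \<le> N" and t: "0 < t" "t \<le> t0" and Nt: "1 \<le> N * t"
      and w: "spread V N t K (Suc l) w" and tot: "1 \<le> wdeg V w {}"
    for V :: "'v set" and N t w
  proof -
    have N: "0 < N" using Nt t by (smt (verit) mult_nonpos_nonneg)
    \<comment> \<open>Rounding up at most doubles the value, since
      \<open>1 \<le> N * t\<close>.\<close>
    define q where "q = nat \<lceil>N * t\<rceil>"
    have q: "N * t \<le> real q" "real q \<le> 2 * (N * t)" "0 < q" unfolding q_def using Nt by linarith+
    define thr :: "'v set \<Rightarrow> real" where "thr = (\<lambda>T. K' * t ^ card T / N)"
    let ?J = "{I. I \<subseteq> V \<and> edge_free w I}"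
    let ?P = "\<lambda>I (S, w'). S \<subseteq> I \<and> card S \<le> q \<and> spread V N t ((K + K') * t) l w' \<and> edge_free w' I \<and>
       (\<forall>u\<in>I - S. real q * wdeg V (residual V thr w w') {u} \<le> wdeg V w' {})"
    let ?Q = "\<lambda>I C. I \<subseteq> C \<and> C \<subseteq> V \<and> real (card C) \<le> real (card V) - \<delta> * N"
    have acc: "fingerprinted ?J (real q) ?P"
      using accumulate_links[OF fin w _ _ t(1) N thr_def, of q] Suc.prems K' by simp
    have A2p: "0 \<le> A2 * (N * t)" using IH(2) Nt by simp
    have "fingerprinted {I \<in> ?J. ?P I z} (A2 * (N * t)) ?Q" for z
    proof (cases "{I \<in> ?J. ?P I z} = {}")
      case True
      show ?thesis unfolding True by (rule fingerprinted_return[OF A2p]) simp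
    next
      case False
      obtain S w' where z: "z = (S, w')" by (cases z)
      \<comment> \<open>The pair \<open>z\<close> is arbitrary; its properties come from an input
        \<open>I\<close> that attains it.\<close>
      have w': "spread V N t ((K + K') * t) l w'" and cS: "card S \<le> q" and SV: "S \<subseteq> V" using False z by auto
      show ?thesis
      proof (cases "t / 4 \<le> wdeg V w' {}")
        case True
        \<comment> \<open>The factor \<open>4 / t\<close> restores total weight 1. It also cancels
          the extra \<open>t\<close> in the degree bound, leaving the constant
          \<open>K2\<close>.\<close>
        let ?w2 = "\<lambda>A. 4 / t * w' A"
        have w2: "spread V N t K2 l ?w2"
          unfolding spread_def
        proof (intro conjI allI impI)
          fix A show "0 \<le> ?w2 A" using t spread_nonneg[OF w', of A] by simp
        next
          fix A assume "?w2 A \<noteq> 0"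
          then have "w' A \<noteq> 0" by auto
          then show "A \<subseteq> V" "card A = l" using spread_support[OF w'] by auto
        next
          fix T assume T: "T \<subseteq> V" "T \<noteq> {}"
          have "wdeg V ?w2 T = 4 / t * wdeg V w' T" by (rule wdeg_scale)
          also have "\<dots> \<le> 4 / t * ((K + K') * t * t ^ (card T - 1) / N)"
            using t by (intro mult_left_mono spread_wdeg[OF w' T]) auto
          also have "\<dots> = K2 * t ^ (card T - 1) / N" unfolding K2_def using t by simp
          finally show "wdeg V ?w2 T \<le> K2 * t ^ (card T - 1) / N" .
        qed
        have w2': "1 \<le> wdeg V ?w2 {}" unfolding wdeg_scale using True t by (simp add: field_simps)
        have "t \<le> t2" using t t0 by linarith
        note IH'[rule_format, OF fin cV t(1) this Nt w2 w2']
        then have "fingerprinted {I. I \<subseteq> V \<and> edge_free ?w2 I} (A2 * (N * t))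
            (\<lambda>I C. I \<subseteq> C \<and> C \<subseteq> V \<and> real (card C) \<le> real (card V) - \<delta>2 * N)"
          .
        then show ?thesis
        proof (rule fingerprinted_mono)
          show "{I \<in> ?J. ?P I z} \<subseteq> {I. I \<subseteq> V \<and> edge_free ?w2 I}"
            using z by (auto simp: edge_free_def)
          have "\<delta> * N \<le> \<delta>2 * N" using \<delta> N by simp
          then show "?Q I C" if "I \<subseteq> C \<and> C \<subseteq> V \<and> real (card C) \<le> real (card V) - \<delta>2 * N" for I C
            using that by linarith
        qed simp
      next
        case low: False
        let ?r = "residual V thr w w'"
        let ?H = "{v \<in> V. 1 / (4 * N) < wdeg V ?r {v}}"
        have r0: "0 \<le> ?r A" for A by (rule residual_nonneg, rule spread_nonneg[OF w])
        have "wdeg V w {} - wdeg V w' {} / t \<le> wdeg V ?r {}"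
          by (rule wdeg_residual_ge[OF fin w w' Suc.prems t(1) N]) (simp add: thr_def K'_def)
        moreover have "wdeg V w' {} / t \<le> 1 / 4" using low t by (simp add: field_simps)
        ultimately have rtot: "3 / 4 \<le> wdeg V ?r {}" using tot by simp
        have H: "N / (2 * K) \<le> real (card ?H)"
        proof (rule card_high_degree_ge[OF fin cV Suc.prems N r0 _ _ rtot])
          fix A assume "?r A \<noteq> 0"
          then have "w A \<noteq> 0" unfolding residual_def by (auto split: if_splits)
          then have "card A = Suc l" by (rule spread_support[OF w])
          then show "A \<noteq> {}" by auto
        next
          fix v assume v: "v \<in> V"
          have "wdeg V ?r {v} \<le> wdeg V w {v}"
            by (rule wdeg_mono, rule residual_le, rule spread_nonneg[OF w])
          also have "\<dots> \<le> K * t ^ (card {v} - 1) / N" using v by (intro spread_wdeg[OF w]) auto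
          finally show "wdeg V ?r {v} \<le> K / N" by simp
        qed
        \<comment> \<open>The vertices of \<open>S\<close> are kept because they belong to
          \<open>I\<close>. The container depends on \<open>z\<close> alone, hence needs no further
          fingerprint.\<close>
        let ?C = "V - (?H - S)"
        have "card ?C = card V - card (?H - S)" using fin by (intro card_Diff_subset) auto
        moreover have "card (?H - S) \<le> card V" using fin by (intro card_mono) auto
        moreover have "card ?H \<le> card (?H - S) + card S"
          using diff_card_le_card_Diff[of S ?H] SV fin finite_subset by fastforce
        ultimately have "real (card ?C) \<le> real (card V) - real (card ?H) + real q" using cS by linarith
        also have "\<dots> \<le> real (card V) - N / (2 * K) + 2 * (N * t)" using H q by linarith
        also have "\<dots> \<le> real (card V) - \<delta> * N"
        proof -
          have "t \<le> 1 / (8 * K)" using t t0 by linarith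
          then have "N * t \<le> N * (1 / (8 * K))" using N by (intro mult_left_mono) auto
          moreover have "\<delta> * N \<le> 1 / (4 * K) * N" using \<delta> N by (intro mult_right_mono) auto
          moreover have "N / (2 * K) = 1 / (4 * K) * N + 2 * (N * (1 / (8 * K)))"
            using Suc.prems by (simp add: field_simps)
          ultimately show ?thesis by linarith
        qed
        finally have cC: "real (card ?C) \<le> real (card V) - \<delta> * N" .
        show ?thesis
        proof (rule fingerprinted_return[OF A2p, of _ _ ?C])
          fix I assume "I \<in> {I \<in> ?J. ?P I z}"
          then have I: "I \<subseteq> V" "\<And>u. u \<in> I - S \<Longrightarrow> real q * wdeg V ?r {u} \<le> wdeg V w' {}" using z by auto
          have "I \<subseteq> ?C"
          proof
            fix u assume u: "u \<in> I"
            have "u \<notin> ?H" if "u \<notin> S"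
            proof -
              \<comment> \<open>The averaging invariant: \<open>N * t\<close> times the residual
                degree of \<open>u\<close> is at most the collected weight, which is below
                \<open>t / 4\<close>.\<close>
              have "N * t * wdeg V ?r {u} \<le> real q * wdeg V ?r {u}"
                using q by (intro mult_right_mono wdeg_nonneg r0)
              also have "\<dots> \<le> wdeg V w' {}" using I(2) u that by blast
              also have "\<dots> \<le> t / 4" using low by simp
              finally have "N * wdeg V ?r {u} \<le> 1 / 4" using t by (simp add: field_simps)
              then have "wdeg V ?r {u} \<le> 1 / (4 * N)" using N by (simp add: field_simps)
              then show ?thesis by simp
            qed
            then show "u \<in> ?C" using u I(1) by blast
          qed
          then show "?Q I ?C" using cC by blast
        qed
      qed
    qed
    then have "fingerprinted ?J (real q + A2 * (N * t)) ?Q" using fingerprinted_bind[OF acc] by blast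
    then show ?thesis
      by (rule fingerprinted_mono) (use q in \<open>auto simp: algebra_simps\<close>)
  qed
  show ?case
    by (rule exI[of _ \<delta>], intro conjI exI[of _ "A2 + 2"] exI[of _ t0] allI impI main)
      (use \<delta>(1) t0(1) IH(2) in simp_all)
qed

text \<open>As long as the current container satisfies \<open>L\<close>, it carries a spread
  hypergraph and can be shrunk by \<open>\<delta> * N\<close> vertices. This can happen only
  boundedly often. The hypergraph may change from round to round; all its edges come from the common
  family \<open>\<E>\<close>, so the same independent sets are treated throughout.\<close>

lemma container_iterated:
  fixes l :: nat
  assumes "0 < K"
  shows "\<exists>A\<ge>0. \<exists>t0>0. \<forall>(V :: 'v set) N t \<E> L. finite V \<longrightarrow> real (card V) \<le> N \<longrightarrow> 0 < t \<longrightarrow> t \<le> t0 \<longrightarrow>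
    1 \<le> N * t \<longrightarrow>
    (\<forall>W\<subseteq>V. L W \<longrightarrow> (\<exists>w. spread W N t K l w \<and> 1 \<le> wdeg W w {} \<and> (\<forall>A. w A \<noteq> 0 \<longrightarrow> A \<in> \<E>))) \<longrightarrow>
    fingerprinted {I. I \<subseteq> V \<and> (\<forall>A\<in>\<E>. \<not> A \<subseteq> I)} (A * (N * t)) (\<lambda>I C. I \<subseteq> C \<and> C \<subseteq> V \<and> \<not> L C)"
proof -
  obtain \<delta> A t0 where c: "\<delta> > 0" "A \<ge> 0" "t0 > 0" and c': "\<forall>(V :: 'v set) N t w. finite V \<longrightarrow> real (card V) \<le> N \<longrightarrow> 0 < t \<longrightarrow> t \<le> t0 \<longrightarrow>
    1 \<le> N * t \<longrightarrow> spread V N t K l w \<longrightarrow> 1 \<le> wdeg V w {} \<longrightarrow>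
    fingerprinted {I. I \<subseteq> V \<and> edge_free w I} (A * (N * t))
      (\<lambda>I C. I \<subseteq> C \<and> C \<subseteq> V \<and> real (card C) \<le> real (card V) - \<delta> * N)"
    using container_single[OF assms, of l] by (elim exE conjE)
  \<comment> \<open>More than \<open>1 / \<delta>\<close> rounds would leave fewer than zero
    vertices.\<close>
  define k where "k = Suc (nat \<lceil>1 / \<delta>\<rceil>)"
  have k: "1 < real k * \<delta>"
  proof -
    have "1 / \<delta> < real k" unfolding k_def by linarith
    then show ?thesis using c(1) by (simp add: field_simps)
  qed
  have main: "fingerprinted {I. I \<subseteq> V \<and> (\<forall>A\<in>\<E>. \<not> A \<subseteq> I)} (real k * A * (N * t)) (\<lambda>I C. I \<subseteq> C \<and> C \<subseteq> V \<and> \<not> L C)"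
    if fin: "finite V" and cV: "real (card V) \<le> N" and t: "0 < t" "t \<le> t0" "1 \<le> N * t"
      and w: "\<And>W. W \<subseteq> V \<Longrightarrow> L W \<Longrightarrow> \<exists>w. spread W N t K l w \<and> 1 \<le> wdeg W w {} \<and> (\<forall>A. w A \<noteq> 0 \<longrightarrow> A \<in> \<E>)"
    for V :: "'v set" and N t \<E> L
  proof -
    let ?J = "{I. I \<subseteq> V \<and> (\<forall>A\<in>\<E>. \<not> A \<subseteq> I)}"
    \<comment> \<open>The disjunction lets a container that fails \<open>L\<close> pass unchanged
      through the remaining rounds.\<close>
    let ?P = "\<lambda>j I C. I \<subseteq> C \<and> C \<subseteq> V \<and> (\<not> L C \<or> real (card C) \<le> real (card V) - real j * \<delta> * N)"
    have N: "0 < N" using t by (smt (verit) mult_nonpos_nonneg)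
    have q0: "0 \<le> A * (N * t)" using c(2) t by simp
    have "fingerprinted ?J (real j * A * (N * t)) (?P j)" for j
    proof (induction j)
      case 0
      then show ?case by (intro fingerprinted_return[of _ _ _ V]) auto
    next
      case (Suc j)
      have "fingerprinted {I \<in> ?J. ?P j I C} (A * (N * t)) (?P (Suc j))" for C
      proof (cases "L C \<and> C \<subseteq> V \<and> real (card C) \<le> real (card V) - real j * \<delta> * N")
        case True
        then have "\<exists>w. spread C N t K l w \<and> 1 \<le> wdeg C w {} \<and> (\<forall>A. w A \<noteq> 0 \<longrightarrow> A \<in> \<E>)"
          by (intro w) simp_all
        then obtain w where w: "spread C N t K l w" "1 \<le> wdeg C w {}" "\<And>A. w A \<noteq> 0 \<Longrightarrow> A \<in> \<E>"
          by blast
        have finC: "finite C" using True fin finite_subset by blast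
        have "card C \<le> card V" using True fin card_mono by blast
        then have cC: "real (card C) \<le> N" using cV by simp
        have 1: "fingerprinted {I. I \<subseteq> C \<and> edge_free w I} (A * (N * t))
          (\<lambda>I C'. I \<subseteq> C' \<and> C' \<subseteq> C \<and> real (card C') \<le> real (card C) - \<delta> * N)"
          by (rule c'[rule_format, OF finC cC t w(1,2)])
        show ?thesis
        proof (rule fingerprinted_mono[OF 1])
          show "{I \<in> ?J. ?P j I C} \<subseteq> {I. I \<subseteq> C \<and> edge_free w I}"
            using w(3) unfolding edge_free_def by blast
          fix I C' assume "I \<subseteq> C' \<and> C' \<subseteq> C \<and> real (card C') \<le> real (card C) - \<delta> * N"
          moreover have "real (Suc j) * \<delta> * N = real j * \<delta> * N + \<delta> * N" by (simp add: algebra_simps)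
          ultimately show "?P (Suc j) I C'" using True by auto
        qed simp
      next
        case False
        show ?thesis
          by (rule fingerprinted_return[OF q0, of _ _ C]) (use False in auto)
      qed
      then have "fingerprinted ?J (real j * A * (N * t) + A * (N * t)) (?P (Suc j))"
        using fingerprinted_bind[OF Suc.IH] by blast
      then show ?case by (rule fingerprinted_mono) (auto simp: algebra_simps)
    qed
    from this[of k] show ?thesis
    proof (rule fingerprinted_mono)
      have "1 * N < real k * \<delta> * N" using k N by (intro mult_strict_right_mono)
      then have "\<not> real (card C) \<le> real (card V) - real k * \<delta> * N" for C :: "'v set"
        using cV by simp
      then show "I \<subseteq> C \<and> C \<subseteq> V \<and> \<not> L C" if "?P k I C" for I C using that by blast
    qed simp_all
  qed
  show ?thesis
  proof (rule exI[of _ "real k * A"], intro conjI exI[of _ t0] allI impI)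
    show "0 \<le> real k * A" using c(2) by simp
    show "0 < t0" by (rule c(3))
    fix V :: "'v set" and N t \<E> L
    assume a: "finite V" "real (card V) \<le> N" "0 < t" "t \<le> t0" "1 \<le> N * t"
      "\<forall>W\<subseteq>V. L W \<longrightarrow> (\<exists>w. spread W N t K l w \<and> 1 \<le> wdeg W w {} \<and> (\<forall>A. w A \<noteq> 0 \<longrightarrow> A \<in> \<E>))"
    show "fingerprinted {I. I \<subseteq> V \<and> (\<forall>A\<in>\<E>. \<not> A \<subseteq> I)} (real k * A * (N * t)) (\<lambda>I C. I \<subseteq> C \<and> C \<subseteq> V \<and> \<not> L C)"
      by (rule main[OF a(1-5)]) (rule a(6)[rule_format])
  qed
qed

section \<open>Ramsey patterns\<close>

text \<open>Vertices \<open>e i\<close> and \<open>M + e i\<close> lie in the two halves of \<open>{..<2 * M}\<close>; one application of Ramsey's theorem with the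
  eight colours given by three bits treats both halves and the pairs between them at once.\<close>

lemma ramsey_bipartite_pattern:
  fixes h :: nat
  shows "\<exists>M>0. \<forall>c :: nat set \<Rightarrow> colour. \<exists>e a b d. strict_mono_on {..<h} e \<and> e ` {..<h} \<subseteq> {..<M} \<and>
    (\<forall>i j. i < j \<longrightarrow> j < h \<longrightarrow> (c {e i, e j} = Red \<longleftrightarrow> a) \<and> (c {M + e i, M + e j} = Red \<longleftrightarrow> b)
        \<and> (c {e i, M + e j} = Red \<longleftrightarrow> d))"
proof -
  obtain M0 :: nat where M0: "partn_lst {..<M0} (replicate 8 h) 2" using ramsey_full by blast
  define M where "M = Suc M0"
  have part: "partn_lst {..<M} (replicate 8 h) 2"
    unfolding M_def by (rule partn_lst_greater_resource[OF M0]) simp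
  have "\<exists>e a b d. strict_mono_on {..<h} e \<and> e ` {..<h} \<subseteq> {..<M} \<and>
    (\<forall>i j. i < j \<longrightarrow> j < h \<longrightarrow> (c {e i, e j} = Red \<longleftrightarrow> a) \<and> (c {M + e i, M + e j} = Red \<longleftrightarrow> b)
        \<and> (c {e i, M + e j} = Red \<longleftrightarrow> d))" for c :: "nat set \<Rightarrow> colour"
  proof -
    \<comment> \<open>The three bits of the colour of a pair. \<open>Min\<close> and
      \<open>Max\<close> orient it, so the cross bit always joins the smaller element in the first
      half to the larger one in the second.\<close>
    define f :: "nat set \<Rightarrow> nat" where "f = (\<lambda>s. of_bool (c s = Red) + 2 * of_bool (c ((+) M ` s) = Red)
        + 4 * of_bool (c {Min s, M + Max s} = Red))"
    have "f \<in> nsets {..<M} 2 \<rightarrow> {..<8}" unfolding f_def by auto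
    then obtain i0 Q where i0: "i0 < 8" "Q \<in> nsets {..<M} (replicate 8 h ! i0)" "f ` nsets Q 2 \<subseteq> {i0}"
      by (rule partn_lstE[OF part]) auto
    then have Q: "Q \<subseteq> {..<M}" "finite Q" "card Q = h" unfolding nsets_def by auto
    obtain e where e: "bij_betw e {..<h} Q" "strict_mono_on {..<h} e"
      using ex_bij_betw_strict_mono_card[OF Q(2)] Q(3) by metis
    define a where "a \<longleftrightarrow> odd i0"
    define b where "b \<longleftrightarrow> odd (i0 div 2)"
    define d where "d \<longleftrightarrow> odd (i0 div 4)"
    have "(c {e i, e j} = Red \<longleftrightarrow> a) \<and> (c {M + e i, M + e j} = Red \<longleftrightarrow> b)
        \<and> (c {e i, M + e j} = Red \<longleftrightarrow> d)" if "i < j" "j < h" for i j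
    proof -
      have lt: "e i < e j" using strict_mono_onD[OF e(2)] that by auto
      have "e i \<in> Q" "e j \<in> Q" using e(1) that unfolding bij_betw_def by auto
      then have "{e i, e j} \<in> nsets Q 2" using lt by simp
      then have "f {e i, e j} = i0" using i0 by blast
      then have i0': "i0 = of_bool (c {e i, e j} = Red) + 2 * of_bool (c {M + e i, M + e j} = Red)
        + 4 * of_bool (c {e i, M + e j} = Red)" unfolding f_def using lt by simp
      show ?thesis unfolding a_def b_def d_def i0' by (auto simp: of_bool_def)
    qed
    moreover have "e ` {..<h} \<subseteq> {..<M}" using e(1) Q(1) unfolding bij_betw_def by blast
    ultimately show ?thesis using e(2) by blast
  qed
  then show ?thesis unfolding M_def by blast
qed

lemma independence_number_witness:
  assumes "simple_graph H"
  obtains S where "independent_set H S" "card S = independence_number H"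
proof -
  let ?X = "{card S | S. independent_set H S}"
  have fin: "finite (verts H)" using assms unfolding simple_graph_def by blast
  have "?X \<subseteq> card ` Pow (verts H)" unfolding independent_set_def by blast
  then have "finite ?X" using fin finite_subset by blast
  moreover have "independent_set H {}" using assms unfolding independent_set_def simple_graph_def by auto
  then have "?X \<noteq> {}" by blast
  ultimately have "independence_number H \<in> ?X" unfolding independence_number_def by (rule Max_in)
  then obtain S where "independence_number H = card S" "independent_set H S" by (elim CollectE exE conjE)
  then show ?thesis using that by simp
qed

text \<open>Let \<open>S\<close> be a maximum independent set. A red clique in the first half or a
  blue clique in the second takes all of \<open>H\<close>. Otherwise the first half is blue and the
  second red. If the cross pairs are red, \<open>S\<close> goes to the first half and the rest to
  the second; if they are blue, the halves are exchanged. No edge lies inside \<open>S\<close>, so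
  all edges get the colour of the cross pairs.\<close>

lemma ramsey_pattern:
  fixes H :: "'a graph"
  assumes H: "simple_graph H"
  shows "\<exists>M>0. \<forall>c :: nat set \<Rightarrow> colour. \<exists>\<psi> col. inj_on \<psi> (verts H) \<and> \<psi> ` verts H \<subseteq> {..<2 * M} \<and>
    (\<forall>e\<in>edges H. c (\<psi> ` e) = col) \<and>
    (col = Red \<longrightarrow> independence_number H \<le> card {v \<in> verts H. \<psi> v < M}) \<and>
    (col = Blue \<longrightarrow> independence_number H \<le> card {v \<in> verts H. M \<le> \<psi> v})"
proof -
  define h where "h = card (verts H)"
  have fin: "finite (verts H)" using H unfolding simple_graph_def by blast
  \<comment> \<open>Length \<open>2 * h\<close> leaves indices below \<open>h\<close> for the first
    half and indices from \<open>h\<close> on for the second in the mixed cases. Cross pairs then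
    always have increasing indices, the only ones the pattern controls.\<close>
  obtain M where M: "M > 0" "\<And>c :: nat set \<Rightarrow> colour. \<exists>e a b d. strict_mono_on {..<2 * h} e \<and> e ` {..<2 * h} \<subseteq> {..<M} \<and>
    (\<forall>i j. i < j \<longrightarrow> j < 2 * h \<longrightarrow> (c {e i, e j} = Red \<longleftrightarrow> a) \<and> (c {M + e i, M + e j} = Red \<longleftrightarrow> b)
        \<and> (c {e i, M + e j} = Red \<longleftrightarrow> d))"
    using ramsey_bipartite_pattern[of "2 * h"] by metis
  obtain S where S: "independent_set H S" "card S = independence_number H"
    using independence_number_witness[OF H] .
  have SV: "S \<subseteq> verts H" using S unfolding independent_set_def by blast
  have edge: "\<exists>u v. e = {u, v} \<and> u \<in> verts H \<and> v \<in> verts H \<and> u \<noteq> v \<and> v \<notin> S" if "e \<in> edges H" for e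
  proof -
    have "e \<subseteq> verts H" "card e = 2" "\<not> e \<subseteq> S" using that H S unfolding simple_graph_def independent_set_def by auto
    then obtain v u where "v \<in> e" "v \<notin> S" "e = {v, u}" "u \<noteq> v"
      by (metis card_2_iff doubleton_eq_iff insert_iff singletonD subsetI)
    then show ?thesis using \<open>e \<subseteq> verts H\<close> by (metis insert_commute insert_subset)
  qed
  obtain \<rho> where \<rho>: "bij_betw \<rho> (verts H) {..<h}"
    using fin ex_bij_betw_finite_nat unfolding h_def lessThan_atLeast0 by blast
  have \<rho>h: "\<rho> v < h" if "v \<in> verts H" for v using \<rho> that unfolding bij_betw_def by blast
  have \<rho>inj: "\<rho> u \<noteq> \<rho> v" if "u \<in> verts H" "v \<in> verts H" "u \<noteq> v" for u v
    using \<rho> that unfolding bij_betw_def inj_on_def by blast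
  have "\<exists>\<psi> col. inj_on \<psi> (verts H) \<and> \<psi> ` verts H \<subseteq> {..<2 * M} \<and>
    (\<forall>e\<in>edges H. c (\<psi> ` e) = col) \<and>
    (col = Red \<longrightarrow> independence_number H \<le> card {v \<in> verts H. \<psi> v < M}) \<and>
    (col = Blue \<longrightarrow> independence_number H \<le> card {v \<in> verts H. M \<le> \<psi> v})" for c :: "nat set \<Rightarrow> colour"
  proof -
    obtain e a b d where e: "strict_mono_on {..<2 * h} e" "e ` {..<2 * h} \<subseteq> {..<M}"
      and abd: "\<And>i j. i < j \<Longrightarrow> j < 2 * h \<Longrightarrow> (c {e i, e j} = Red \<longleftrightarrow> a) \<and> (c {M + e i, M + e j} = Red \<longleftrightarrow> b)
        \<and> (c {e i, M + e j} = Red \<longleftrightarrow> d)"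
      using M(2)[of c] by metis
    have eM: "e i < M" if "i < 2 * h" for i using e that by blast
    have einj: "e i = e j \<longleftrightarrow> i = j" if "i < 2 * h" "j < 2 * h" for i j
      using strict_mono_on_imp_inj_on[OF e(1)] that unfolding inj_on_def by blast
    have AA: "c {e i, e j} = Red \<longleftrightarrow> a" if "i \<noteq> j" "i < 2 * h" "j < 2 * h" for i j
      using abd[of i j] abd[of j i] that by (cases i j rule: linorder_cases) (auto simp: insert_commute)
    have BB: "c {M + e i, M + e j} = Red \<longleftrightarrow> b" if "i \<noteq> j" "i < 2 * h" "j < 2 * h" for i j
      using abd[of i j] abd[of j i] that by (cases i j rule: linorder_cases) (auto simp: insert_commute)
    have AB: "c {e i, M + e j} = Red \<longleftrightarrow> d" if "i < j" "j < 2 * h" for i j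
      using abd[OF that] by blast
    have Blue: "c s = Blue \<longleftrightarrow> c s \<noteq> Red" for s using colour.exhaust by (cases "c s") auto
    \<comment> \<open>It is enough to control pairs whose second vertex is outside \<open>S\<close>,
      since every edge can be written that way.\<close>
    have lift: ?thesis if inj: "inj_on \<psi> (verts H)" and \<psi>: "\<And>v. v \<in> verts H \<Longrightarrow> \<psi> v < 2 * M"
      and mono: "\<And>u v. u \<in> verts H \<Longrightarrow> v \<in> verts H \<Longrightarrow> u \<noteq> v \<Longrightarrow> v \<notin> S \<Longrightarrow> c {\<psi> u, \<psi> v} = col"
      and red: "\<And>v. col = Red \<Longrightarrow> v \<in> S \<Longrightarrow> \<psi> v < M"
      and blue: "\<And>v. col = Blue \<Longrightarrow> v \<in> S \<Longrightarrow> M \<le> \<psi> v" for \<psi> col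
    proof (intro exI[of _ \<psi>] exI[of _ col] conjI impI ballI)
      show "\<psi> ` verts H \<subseteq> {..<2 * M}" using \<psi> by blast
      show "c (\<psi> ` x) = col" if "x \<in> edges H" for x
        using edge[OF that] mono by auto
      show "independence_number H \<le> card {v \<in> verts H. \<psi> v < M}" if "col = Red"
        unfolding S(2)[symmetric] by (rule card_mono) (use red[OF that] SV fin in auto)
      show "independence_number H \<le> card {v \<in> verts H. M \<le> \<psi> v}" if "col = Blue"
        unfolding S(2)[symmetric] by (rule card_mono) (use blue[OF that] SV fin in auto)
    qed (rule inj)
    consider "a" | "\<not> b" | "\<not> a" "b" "d" | "\<not> a" "b" "\<not> d" by blast
    then show ?thesis
    proof cases
      case 1
      show ?thesis
      proof (rule lift[of "\<lambda>v. e (\<rho> v)" Red])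
        show "inj_on (\<lambda>v. e (\<rho> v)) (verts H)"
          unfolding inj_on_def using einj \<rho>h \<rho>inj by (metis mult_2 trans_less_add1)
        show "e (\<rho> v) < 2 * M" if "v \<in> verts H" for v using eM[of "\<rho> v"] \<rho>h[OF that] by simp
        show "c {e (\<rho> u), e (\<rho> v)} = Red" if "u \<in> verts H" "v \<in> verts H" "u \<noteq> v" for u v
          using AA[of "\<rho> u" "\<rho> v"] \<rho>h that \<rho>inj[OF that] 1 by (simp add: trans_less_add1 mult_2)
        show "e (\<rho> v) < M" if "v \<in> S" for v using eM[of "\<rho> v"] \<rho>h[of v] SV that by auto
      qed simp
    next
      case 2
      show ?thesis
      proof (rule lift[of "\<lambda>v. M + e (\<rho> v)" Blue])
        show "inj_on (\<lambda>v. M + e (\<rho> v)) (verts H)"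
          unfolding inj_on_def using einj \<rho>h \<rho>inj by (metis add_left_cancel mult_2 trans_less_add1)
        show "M + e (\<rho> v) < 2 * M" if "v \<in> verts H" for v using eM[of "\<rho> v"] \<rho>h[OF that] by simp
        show "c {M + e (\<rho> u), M + e (\<rho> v)} = Blue" if "u \<in> verts H" "v \<in> verts H" "u \<noteq> v" for u v
          using BB[of "\<rho> u" "\<rho> v"] \<rho>h that \<rho>inj[OF that] 2 Blue by (simp add: trans_less_add1 mult_2)
      qed simp_all
    next
      case 3
      let ?\<psi> = "\<lambda>v. if v \<in> S then e (\<rho> v) else M + e (h + \<rho> v)"
      show ?thesis
      proof (rule lift[of ?\<psi> Red])
        show "inj_on ?\<psi> (verts H)"
        proof (rule inj_onI)
          fix u v assume uv: "u \<in> verts H" "v \<in> verts H" and eq: "?\<psi> u = ?\<psi> v"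
          show "u = v"
            using eq eM[of "\<rho> u"] eM[of "\<rho> v"] \<rho>h[of u] \<rho>h[of v] uv einj[of "\<rho> u" "\<rho> v"]
              einj[of "h + \<rho> u" "h + \<rho> v"] \<rho>inj[of u v] by (auto split: if_splits)
        qed
        show "?\<psi> v < 2 * M" if "v \<in> verts H" for v using eM[of "\<rho> v"] eM[of "h + \<rho> v"] \<rho>h[OF that] by simp
        show "c {?\<psi> u, ?\<psi> v} = Red" if "u \<in> verts H" "v \<in> verts H" "u \<noteq> v" "v \<notin> S" for u v
          using AB[of "\<rho> u" "h + \<rho> v"] BB[of "h + \<rho> u" "h + \<rho> v"] \<rho>h[of u] \<rho>h[of v] that
            \<rho>inj[OF that(1-3)] 3 by auto
        show "?\<psi> v < M" if "v \<in> S" for v using eM[of "\<rho> v"] \<rho>h[of v] SV that by auto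
      qed simp
    next
      case 4
      let ?\<psi> = "\<lambda>v. if v \<in> S then M + e (h + \<rho> v) else e (\<rho> v)"
      show ?thesis
      proof (rule lift[of ?\<psi> Blue])
        show "inj_on ?\<psi> (verts H)"
        proof (rule inj_onI)
          fix u v assume uv: "u \<in> verts H" "v \<in> verts H" and eq: "?\<psi> u = ?\<psi> v"
          show "u = v"
            using eq eM[of "\<rho> u"] eM[of "\<rho> v"] \<rho>h[of u] \<rho>h[of v] uv einj[of "\<rho> u" "\<rho> v"]
              einj[of "h + \<rho> u" "h + \<rho> v"] \<rho>inj[of u v] by (auto split: if_splits)
        qed
        show "?\<psi> v < 2 * M" if "v \<in> verts H" for v using eM[of "\<rho> v"] eM[of "h + \<rho> v"] \<rho>h[OF that] by simp
        show "c {?\<psi> u, ?\<psi> v} = Blue" if "u \<in> verts H" "v \<in> verts H" "u \<noteq> v" "v \<notin> S" for u v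
          using AB[of "\<rho> v" "h + \<rho> u"] AA[of "\<rho> u" "\<rho> v"] \<rho>h[of u] \<rho>h[of v] that
            \<rho>inj[OF that(1-3)] 4 Blue by (auto simp: insert_commute)
      qed simp_all
    qed
  qed
  then show ?thesis using M(1) by blast
qed

section \<open>Coloured copies\<close>

lemma card_PiE_fixed_le:
  assumes "finite I" "\<And>i. i \<in> I \<Longrightarrow> finite (B i) \<and> card (B i) = s" "J \<subseteq> I"
  shows "card {g \<in> PiE I B. \<forall>i\<in>J. g i = a i} \<le> s ^ (card I - card J)"
proof -
  let ?B = "\<lambda>i. if i \<in> J then {a i} else B i"
  have "{g \<in> PiE I B. \<forall>i\<in>J. g i = a i} \<subseteq> PiE I ?B" by (auto simp: PiE_def extensional_def Pi_def)
  moreover have "finite (PiE I ?B)" using assms by (intro finite_PiE) auto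
  ultimately have "card {g \<in> PiE I B. \<forall>i\<in>J. g i = a i} \<le> card (PiE I ?B)" by (intro card_mono)
  also have "\<dots> = (\<Prod>i\<in>I. card (?B i))" by (rule card_PiE[OF assms(1)])
  also have "\<dots> = (\<Prod>i\<in>I - J. card (?B i)) * (\<Prod>i\<in>J. card (?B i))"
    by (rule prod.subset_diff[OF assms(3,1)])
  also have "(\<Prod>i\<in>J. card (?B i)) = 1" by simp
  also have "(\<Prod>i\<in>I - J. card (?B i)) = s ^ card (I - J)" using assms(2) by simp
  also have "card (I - J) = card I - card J"
    using assms(1,3) finite_subset by (intro card_Diff_subset) auto
  finally show ?thesis by simp
qed

text \<open>A map whose image covers \<open>U\<close> determines an injection of \<open>U\<close>
  into \<open>I\<close> by choosing preimages. There are at most \<open>card I ^ card U\<close>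
  injections, and each one fixes \<open>card U\<close> values of the map.\<close>

lemma card_PiE_image_superset_le:
  assumes "finite I" "\<And>i. i \<in> I \<Longrightarrow> finite (B i) \<and> card (B i) = s" "finite U"
  shows "card {g \<in> PiE I B. U \<subseteq> g ` I} \<le> card I ^ card U * s ^ (card I - card U)"
proof -
  let ?\<I> = "{\<iota> \<in> U \<rightarrow>\<^sub>E I. inj_on \<iota> U}"
  let ?G = "\<lambda>\<iota>. {g \<in> PiE I B. \<forall>i\<in>\<iota> ` U. g i = inv_into U \<iota> i}"
  have fin: "finite (U \<rightarrow>\<^sub>E I)" using assms by (intro finite_PiE) auto
  then have fin': "finite ?\<I>" by simp
  have finG: "finite (PiE I B)" using assms by (intro finite_PiE) auto
  have "{g \<in> PiE I B. U \<subseteq> g ` I} \<subseteq> (\<Union>\<iota>\<in>?\<I>. ?G \<iota>)"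
  proof
    fix g assume "g \<in> {g \<in> PiE I B. U \<subseteq> g ` I}"
    then have g: "g \<in> PiE I B" "U \<subseteq> g ` I" by auto
    define \<iota> where "\<iota> = restrict (inv_into I g) U"
    have inv: "g (\<iota> x) = x" "\<iota> x \<in> I" if "x \<in> U" for x
      using that g(2) unfolding \<iota>_def by (auto simp: f_inv_into_f inv_into_into subset_iff)
    have inj: "inj_on \<iota> U" by (rule inj_on_inverseI[of _ g]) (rule inv)
    have "\<iota> \<in> U \<rightarrow>\<^sub>E I" using inv unfolding \<iota>_def by auto
    moreover have "g i = inv_into U \<iota> i" if "i \<in> \<iota> ` U" for i
      using that inv inj by (auto simp: inv_into_f_f)
    ultimately show "g \<in> (\<Union>\<iota>\<in>?\<I>. ?G \<iota>)" using inj g(1) by blast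
  qed
  then have "card {g \<in> PiE I B. U \<subseteq> g ` I} \<le> card (\<Union>\<iota>\<in>?\<I>. ?G \<iota>)"
    using fin' finG by (intro card_mono finite_UN_I) auto
  also have "\<dots> \<le> (\<Sum>\<iota>\<in>?\<I>. card (?G \<iota>))" by (rule card_UN_le[OF fin'])
  also have "\<dots> \<le> (\<Sum>\<iota>\<in>?\<I>. s ^ (card I - card U))"
  proof (rule sum_mono)
    fix \<iota> assume "\<iota> \<in> ?\<I>"
    then have sub: "\<iota> ` U \<subseteq> I" and c: "card (\<iota> ` U) = card U" by (auto simp: card_image)
    show "card (?G \<iota>) \<le> s ^ (card I - card U)"
      unfolding c[symmetric] by (rule card_PiE_fixed_le[OF assms(1,2) sub])
  qed
  also have "\<dots> = card ?\<I> * s ^ (card I - card U)" by simp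
  also have "card ?\<I> \<le> card (U \<rightarrow>\<^sub>E I)" using fin by (intro card_mono) auto
  also have "card (U \<rightarrow>\<^sub>E I) = card I ^ card U" using assms(3) by (simp add: card_PiE)
  finally show ?thesis by simp
qed

text \<open>Union bound over the two positions and over the pair in \<open>R\<close> that they take;
  this fixes two values.\<close>

lemma card_PiE_related_pair_le:
  assumes "finite I" "\<And>i. i \<in> I \<Longrightarrow> finite (B i) \<and> card (B i) = s" "finite R"
  shows "card {g \<in> PiE I B. \<exists>i\<in>I. \<exists>j\<in>I. i \<noteq> j \<and> (g i, g j) \<in> R} \<le> card I ^ 2 * card R * s ^ (card I - 2)"
proof -
  let ?Q = "{p \<in> I \<times> I. fst p \<noteq> snd p} \<times> R"
  let ?G = "\<lambda>q. {g \<in> PiE I B. \<forall>k\<in>{fst (fst q), snd (fst q)}. g k = (if k = fst (fst q) then fst (snd q) else snd (snd q))}"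
  have finQ: "finite ?Q" using assms by auto
  have finG: "finite (PiE I B)" using assms by (intro finite_PiE) auto
  have "{g \<in> PiE I B. \<exists>i\<in>I. \<exists>j\<in>I. i \<noteq> j \<and> (g i, g j) \<in> R} \<subseteq> (\<Union>q\<in>?Q. ?G q)"
  proof
    fix g assume "g \<in> {g \<in> PiE I B. \<exists>i\<in>I. \<exists>j\<in>I. i \<noteq> j \<and> (g i, g j) \<in> R}"
    then obtain i j where g: "g \<in> PiE I B" "i \<in> I" "j \<in> I" "i \<noteq> j" "(g i, g j) \<in> R" by blast
    then have "((i, j), (g i, g j)) \<in> ?Q" "g \<in> ?G ((i, j), (g i, g j))" by auto
    then show "g \<in> (\<Union>q\<in>?Q. ?G q)" by (rule UN_I)
  qed
  then have "card {g \<in> PiE I B. \<exists>i\<in>I. \<exists>j\<in>I. i \<noteq> j \<and> (g i, g j) \<in> R} \<le> card (\<Union>q\<in>?Q. ?G q)"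
    using finQ finG by (intro card_mono finite_UN_I) auto
  also have "\<dots> \<le> (\<Sum>q\<in>?Q. card (?G q))" by (rule card_UN_le[OF finQ])
  also have "\<dots> \<le> (\<Sum>q\<in>?Q. s ^ (card I - 2))"
  proof (rule sum_mono)
    fix q assume q: "q \<in> ?Q"
    then have sub: "{fst (fst q), snd (fst q)} \<subseteq> I" and c: "card {fst (fst q), snd (fst q)} = 2" by auto
    show "card (?G q) \<le> s ^ (card I - 2)"
      unfolding c[symmetric] by (rule card_PiE_fixed_le[OF assms(1,2) sub])
  qed
  also have "\<dots> = card ?Q * s ^ (card I - 2)" by simp
  also have "card ?Q \<le> card I ^ 2 * card R"
  proof -
    have "card ?Q = card {p \<in> I \<times> I. fst p \<noteq> snd p} * card R" by (rule card_cartesian_product)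
    also have "card {p \<in> I \<times> I. fst p \<noteq> snd p} \<le> card (I \<times> I)" using assms(1) by (intro card_mono) auto
    finally show ?thesis by (simp add: card_cartesian_product power2_eq_square)
  qed
  finally show ?thesis by simp
qed

lemma card_pairs_of_edges_le:
  assumes "finite D" "\<And>e. e \<in> D \<Longrightarrow> card e = 2"
  shows "finite {(x, y). {x, y} \<in> D}" "card {(x, y). {x, y} \<in> D} \<le> 2 * card D"
proof -
  have eq: "{(x, y). {x, y} \<in> D} = (\<Union>e\<in>D. {(x, y). {x, y} = e})" by auto
  have *: "finite {(x, y). {x, y} = e} \<and> card {(x, y). {x, y} = e} \<le> 2" if e: "e \<in> D" for e
  proof -
    obtain a b where "e = {a, b}" using assms(2)[OF e] by (meson card_2_iff)
    then have sub: "{(x, y). {x, y} = e} \<subseteq> {(a, b), (b, a)}" by (auto simp: doubleton_eq_iff)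
    have "card {(x, y). {x, y} = e} \<le> card {(a, b), (b, a)}" by (rule card_mono[OF _ sub]) simp
    also have "\<dots> \<le> 2" using card_insert_le_m1[of 2 "{(b, a)}" "(a, b)"] by simp
    finally show ?thesis using sub finite_subset by blast
  qed
  show "finite {(x, y). {x, y} \<in> D}" unfolding eq using assms(1) * by blast
  have "card (\<Union>e\<in>D. {(x, y). {x, y} = e}) \<le> (\<Sum>e\<in>D. card {(x, y). {x, y} = e})" by (rule card_UN_le[OF assms(1)])
  also have "\<dots> \<le> (\<Sum>e\<in>D. 2)" by (rule sum_mono) (use * in blast)
  finally show "card {(x, y). {x, y} \<in> D} \<le> 2 * card D" unfolding eq by simp
qed

text \<open>If \<open>T\<close> spans at least three vertices, it has at least two edges, and the
  subgraph it spans is a candidate in the maximum defining \<open>m2_density\<close>. If it spans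
  two, it is a single edge and both sides vanish; the product form avoids dividing by zero
  there.\<close>

lemma m2_density_bound:
  assumes H: "simple_graph H" and T: "T \<subseteq> edges H" "T \<noteq> {}"
  shows "2 \<le> card (\<Union>T)" "real (card T) - 1 \<le> max (m2_density H) 1 * (real (card (\<Union>T)) - 2)"
proof -
  have finV: "finite (verts H)" and E: "\<And>e. e \<in> edges H \<Longrightarrow> e \<subseteq> verts H \<and> card e = 2"
    using H unfolding simple_graph_def by auto
  have finE: "finite (edges H)" by (rule finite_subset[of _ "Pow (verts H)"]) (use E finV in auto)
  have finT: "finite T" using T finE finite_subset by blast
  have UV: "\<Union>T \<subseteq> verts H" using T E by blast
  have finU: "finite (\<Union>T)" using UV finV finite_subset by blast
  obtain e where e: "e \<in> T" using T by blast
  have "card e \<le> card (\<Union>T)" using e finU by (intro card_mono) auto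
  then show 2: "2 \<le> card (\<Union>T)" using e T E by auto
  show "real (card T) - 1 \<le> max (m2_density H) 1 * (real (card (\<Union>T)) - 2)"
  proof (cases "card (\<Union>T) = 2")
    case True
    have "f = \<Union>T" if "f \<in> T" for f
      by (rule card_subset_eq[OF finU]) (use that T E True in auto)
    then have "T \<subseteq> {\<Union>T}" by blast
    then have "card T \<le> 1" using card_mono[of "{\<Union>T}" T] by simp
    then show ?thesis using True by simp
  next
    case False
    then have U3: "3 \<le> card (\<Union>T)" using 2 by simp
    have "card T \<noteq> 1"
    proof
      assume "card T = 1"
      then obtain f where "T = {f}" by (rule card_1_singletonE)
      then show False using T E U3 by auto
    qed
    moreover have "card T \<noteq> 0" using finT T by simp
    ultimately have "2 \<le> card T" by simp
    also have "card T \<le> card (edges H)" using finE T by (intro card_mono)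
    finally have E2: "2 \<le> card (edges H)" .
    let ?Q = "{(real (card (edges F)) - 1) / (real (card (verts F)) - 2) | F. subgraph F H \<and> card (verts F) \<ge> 3}"
    have sub: "subgraph (\<Union>T, T) H"
      unfolding subgraph_def simple_graph_def using UV finU T E by auto
    have "?Q \<subseteq> (\<lambda>F. (real (card (edges F)) - 1) / (real (card (verts F)) - 2)) ` (Pow (verts H) \<times> Pow (edges H))"
    proof
      fix x assume "x \<in> ?Q"
      then obtain F where F: "x = (real (card (edges F)) - 1) / (real (card (verts F)) - 2)" "subgraph F H" by blast
      then have "F \<in> Pow (verts H) \<times> Pow (edges H)" unfolding subgraph_def by (cases F) auto
      then show "x \<in> (\<lambda>F. (real (card (edges F)) - 1) / (real (card (verts F)) - 2)) ` (Pow (verts H) \<times> Pow (edges H))"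
        using F(1) by (rule_tac image_eqI)
    qed
    then have finQ: "finite ?Q" using finV finE by (rule_tac finite_subset) auto
    have "(real (card T) - 1) / (real (card (\<Union>T)) - 2) \<in> ?Q"
      by (rule CollectI, rule exI[of _ "(\<Union>T, T)"]) (use sub U3 in simp)
    then have "(real (card T) - 1) / (real (card (\<Union>T)) - 2) \<le> Max ?Q" using finQ by (intro Max_ge)
    also have "\<dots> = m2_density H" unfolding m2_density_def using E2 by simp
    also have "\<dots> \<le> max (m2_density H) 1" by simp
    finally show ?thesis using U3 by (simp add: pos_divide_le_eq)
  qed
qed

text \<open>A coloured copy is the set of its edges, each paired with the colour.\<close>

definition good_copies :: "'a graph \<Rightarrow> 'b set \<Rightarrow> 'b set \<Rightarrow> ('b set \<times> colour) set set" where
  "good_copies H X Y = {(\<lambda>e. (\<psi> ` e, col)) ` edges H | \<psi> col.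
     inj_on \<psi> (verts H) \<and> \<psi> ` verts H \<subseteq> X \<union> Y \<and>
     (col = Red \<longrightarrow> independence_number H \<le> card (\<psi> ` verts H \<inter> X)) \<and>
     (col = Blue \<longrightarrow> independence_number H \<le> card (\<psi> ` verts H \<inter> Y))}"

lemma good_copies_density:
  assumes H: "simple_graph H" and A: "A \<in> good_copies H X Y"
  shows "card A = card (edges H)"
    and "T \<subseteq> A \<Longrightarrow> T \<noteq> {} \<Longrightarrow> 2 \<le> card (\<Union>(fst ` T)) \<and> card (\<Union>(fst ` T)) \<le> card (verts H) \<and>
      real (card T) - 1 \<le> max (m2_density H) 1 * (real (card (\<Union>(fst ` T))) - 2)"
proof -
  obtain \<psi> col where \<psi>: "inj_on \<psi> (verts H)" and A: "A = (\<lambda>e. (\<psi> ` e, col)) ` edges H"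
    using A unfolding good_copies_def by (elim CollectE exE conjE)
  have finV: "finite (verts H)" and E: "\<And>e. e \<in> edges H \<Longrightarrow> e \<subseteq> verts H"
    using H unfolding simple_graph_def by auto
  have inj: "inj_on (\<lambda>e. (\<psi> ` e, col)) (edges H)"
  proof (rule inj_onI)
    fix e f assume "e \<in> edges H" "f \<in> edges H" "(\<psi> ` e, col) = (\<psi> ` f, col)"
    then show "e = f" using inj_on_image_eq_iff[OF \<psi>] E by simp
  qed
  show "card A = card (edges H)" unfolding A by (rule card_image[OF inj])
  show "2 \<le> card (\<Union>(fst ` T)) \<and> card (\<Union>(fst ` T)) \<le> card (verts H) \<and>
      real (card T) - 1 \<le> max (m2_density H) 1 * (real (card (\<Union>(fst ` T))) - 2)"
    if T: "T \<subseteq> A" "T \<noteq> {}"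
  proof -
    obtain T' where T': "T' \<subseteq> edges H" "T = (\<lambda>e. (\<psi> ` e, col)) ` T'"
      using T(1) unfolding A by (meson subset_image_iff)
    have ne: "T' \<noteq> {}" using T T' by blast
    have cT: "card T = card T'" unfolding T' by (rule card_image[OF inj_on_subset[OF inj T'(1)]])
    have U: "\<Union>(fst ` T) = \<psi> ` (\<Union>T')" unfolding T' by auto
    have UV: "\<Union>T' \<subseteq> verts H" using T' E by blast
    have cU: "card (\<Union>(fst ` T)) = card (\<Union>T')" unfolding U by (rule card_image[OF inj_on_subset[OF \<psi> UV]])
    have "card (\<Union>T') \<le> card (verts H)" by (rule card_mono[OF finV UV])
    then show ?thesis unfolding cT cU using m2_density_bound[OF H T'(1) ne] by blast
  qed
qed

lemma wdeg_counting:
  assumes "finite W" "finite G" "\<And>g. g \<in> G \<Longrightarrow> A g \<subseteq> W"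
  shows "wdeg W (\<lambda>B. c * real (card {g \<in> G. A g = B})) T = c * real (card {g \<in> G. T \<subseteq> A g})"
proof -
  have *: "real (card {g \<in> G. P g}) = (\<Sum>g\<in>G. if P g then 1 else 0)" for P
    using assms(2) by (simp add: sum.inter_filter[symmetric])
  have "(\<Sum>B | B \<subseteq> W \<and> T \<subseteq> B. real (card {g \<in> G. A g = B}))
      = (\<Sum>g\<in>G. \<Sum>B | B \<subseteq> W \<and> T \<subseteq> B. if A g = B then 1 else 0)"
    unfolding * by (rule sum.swap)
  also have "\<dots> = (\<Sum>g\<in>G. if T \<subseteq> A g then 1 else 0)"
    by (rule sum.cong) (use assms in auto)
  finally show ?thesis unfolding wdeg_scale unfolding wdeg_def *[symmetric] by simp
qed

text \<open>\<open>W\<close> is pulled back along \<open>g\<close> to a colouring of the pattern,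
  and the monochromatic embedding \<open>\<psi>\<close> found there is composed with
  \<open>g\<close>. The two halves of the pattern land in \<open>X\<close> and \<open>Y\<close>, so
  the independence number condition carries over.\<close>

lemma good_copy_exists:
  fixes H :: "'a graph" and X Y :: "'b set"
  assumes H: "simple_graph H"
    and pat: "\<And>c :: nat set \<Rightarrow> colour. \<exists>\<psi> col. inj_on \<psi> (verts H) \<and> \<psi> ` verts H \<subseteq> {..<2 * M} \<and>
      (\<forall>e\<in>edges H. c (\<psi> ` e) = col) \<and>
      (col = Red \<longrightarrow> independence_number H \<le> card {v \<in> verts H. \<psi> v < M}) \<and>
      (col = Blue \<longrightarrow> independence_number H \<le> card {v \<in> verts H. M \<le> \<psi> v})"
    and g: "g \<in> (\<Pi>\<^sub>E i\<in>{..<2 * M}. if i < M then X else Y)"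
    and inj: "inj_on g {..<2 * M}"
    and present: "\<And>i j. i < 2 * M \<Longrightarrow> j < 2 * M \<Longrightarrow> i \<noteq> j \<Longrightarrow> ({g i, g j}, Red) \<in> W \<or> ({g i, g j}, Blue) \<in> W"
  shows "\<exists>A\<in>good_copies H X Y. A \<subseteq> W \<and> \<Union>(fst ` A) \<subseteq> g ` {..<2 * M}"
proof -
  have gX: "g i \<in> X" if "i < M" for i using PiE_mem[OF g, of i] that by simp
  have gY: "g i \<in> Y" if "M \<le> i" "i < 2 * M" for i using PiE_mem[OF g, of i] that by simp
  have finV: "finite (verts H)" and E: "\<And>e. e \<in> edges H \<Longrightarrow> e \<subseteq> verts H \<and> card e = 2"
    using H unfolding simple_graph_def by auto
  obtain \<psi> col where \<psi>: "inj_on \<psi> (verts H)" "\<psi> ` verts H \<subseteq> {..<2 * M}"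
    and mono: "\<And>e. e \<in> edges H \<Longrightarrow> (if (g ` \<psi> ` e, Red) \<in> W then Red else Blue) = col"
    and red: "col = Red \<Longrightarrow> independence_number H \<le> card {v \<in> verts H. \<psi> v < M}"
    and blue: "col = Blue \<Longrightarrow> independence_number H \<le> card {v \<in> verts H. M \<le> \<psi> v}"
    \<comment> \<open>A pair without its red version in \<open>W\<close> is declared blue;
      \<open>present\<close> then supplies the blue version.\<close>
    using pat[of "\<lambda>\<sigma>. if (g ` \<sigma>, Red) \<in> W then Red else Blue"] by blast
  have lt: "\<psi> v < 2 * M" if "v \<in> verts H" for v using \<psi>(2) that by blast
  define \<phi> where "\<phi> = g \<circ> \<psi>"
  have \<phi>inj: "inj_on \<phi> (verts H)" unfolding \<phi>_def
    by (rule comp_inj_on[OF \<psi>(1)]) (rule inj_on_subset[OF inj \<psi>(2)])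
  define A where "A = (\<lambda>e. (\<phi> ` e, col)) ` edges H"
  have "A \<in> good_copies H X Y"
    unfolding good_copies_def
  proof (intro CollectI exI[of _ \<phi>] exI[of _ col] conjI impI)
    show "A = (\<lambda>e. (\<phi> ` e, col)) ` edges H" by (rule A_def)
    show "inj_on \<phi> (verts H)" by (rule \<phi>inj)
    show "\<phi> ` verts H \<subseteq> X \<union> Y"
    proof
      fix x assume "x \<in> \<phi> ` verts H"
      then obtain v where "v \<in> verts H" "x = g (\<psi> v)" unfolding \<phi>_def by auto
      then show "x \<in> X \<union> Y" using gX[of "\<psi> v"] gY[of "\<psi> v"] lt[of v] by (cases "\<psi> v < M") auto
    qed
    show "independence_number H \<le> card (\<phi> ` verts H \<inter> X)" if "col = Red"
    proof -
      have "card {v \<in> verts H. \<psi> v < M} = card (\<phi> ` {v \<in> verts H. \<psi> v < M})"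
        by (rule card_image[symmetric], rule inj_on_subset[OF \<phi>inj]) auto
      also have "\<dots> \<le> card (\<phi> ` verts H \<inter> X)"
        by (rule card_mono) (use finV gX in \<open>auto simp: \<phi>_def\<close>)
      finally show ?thesis using red[OF that] by simp
    qed
    show "independence_number H \<le> card (\<phi> ` verts H \<inter> Y)" if "col = Blue"
    proof -
      have "card {v \<in> verts H. M \<le> \<psi> v} = card (\<phi> ` {v \<in> verts H. M \<le> \<psi> v})"
        by (rule card_image[symmetric], rule inj_on_subset[OF \<phi>inj]) auto
      also have "\<dots> \<le> card (\<phi> ` verts H \<inter> Y)"
        by (rule card_mono) (use finV gY lt in \<open>auto simp: \<phi>_def\<close>)
      finally show ?thesis using blue[OF that] by simp
    qed
  qed
  moreover have "A \<subseteq> W"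
  proof
    fix x assume "x \<in> A"
    then obtain e where e: "e \<in> edges H" "x = (\<phi> ` e, col)" unfolding A_def by blast
    obtain u v where uv: "e = {u, v}" "u \<noteq> v" using E[OF e(1)] by (meson card_2_iff)
    then have uvV: "u \<in> verts H" "v \<in> verts H" using E[OF e(1)] by auto
    then have "\<psi> u \<noteq> \<psi> v" using \<psi>(1) uv unfolding inj_on_def by blast
    then have "({g (\<psi> u), g (\<psi> v)}, Red) \<in> W \<or> ({g (\<psi> u), g (\<psi> v)}, Blue) \<in> W"
      using present lt uvV by blast
    then show "x \<in> W" using mono[OF e(1)] unfolding e(2) uv \<phi>_def by (auto split: if_splits)
  qed
  moreover have "\<Union>(fst ` A) \<subseteq> g ` {..<2 * M}"
  proof
    fix x assume "x \<in> \<Union>(fst ` A)"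
    then obtain e where "e \<in> edges H" "x \<in> \<phi> ` e" unfolding A_def by auto
    then obtain v where "v \<in> verts H" "x = g (\<psi> v)" using E unfolding \<phi>_def by auto
    then show "x \<in> g ` {..<2 * M}" using lt by blast
  qed
  ultimately show ?thesis by blast
qed

text \<open>This is where the exponent of the threshold enters. The density inequality says
  \<open>(k - 1) / m \<le> u - 2\<close>, so fixing \<open>u\<close> vertices costs at least as much
  as the degree condition allows for \<open>k\<close> coloured edges.\<close>

lemma powr_density_bound:
  fixes n u k :: nat
  assumes "1 \<le> n" "2 \<le> u" "1 \<le> k" "1 \<le> m" "real k - 1 \<le> m * (real u - 2)"
  shows "1 / real n ^ u \<le> (real n powr (- 1 / m)) ^ (k - 1) / (real n)\<^sup>2"
proof -
  have n: "0 < real n" using assms by simp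
  have "(real k - 1) / m \<le> real u - 2" using assms by (simp add: pos_divide_le_eq mult.commute)
  then have "real n powr (- (real u - 2)) \<le> real n powr (- ((real k - 1) / m))"
    using assms by (intro powr_mono) auto
  also have "\<dots> = (real n powr (- 1 / m)) ^ (k - 1)"
    using n assms by (simp add: powr_realpow[symmetric] powr_powr of_nat_diff)
  finally have "real n powr (- (real u - 2)) / (real n)\<^sup>2 \<le> (real n powr (- 1 / m)) ^ (k - 1) / (real n)\<^sup>2"
    by (intro divide_right_mono) auto
  moreover have "real n powr (- (real u - 2)) / (real n)\<^sup>2 = 1 / real n ^ u"
  proof -
    have "real n powr (- (real u - 2)) = real n powr 2 / real n powr (real u)"
      by (simp only: minus_diff_eq powr_diff)
    then show ?thesis using n by (simp add: powr_realpow)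
  qed
  ultimately show ?thesis by simp
qed

text \<open>Both colours must be absent: exactly then the pair is ruled out as an edge inside
  \<open>Z\<close> whatever the colouring is.\<close>

definition missed_pairs :: "nat \<Rightarrow> nat set \<Rightarrow> (nat set \<times> colour) set \<Rightarrow> nat set set" where
  "missed_pairs n Z W = {e \<in> vertex_pairs n. (e, Red) \<notin> W \<and> (e, Blue) \<notin> W \<and> e \<subseteq> Z}"

text \<open>The weight of a copy counts the maps of the Ramsey pattern into \<open>X\<close> and \<open>Y\<close> that select it.\<close>

lemma spread_good_copies:
  fixes H :: "'a graph" and \<epsilon> :: real
  assumes H: "simple_graph H" and \<epsilon>: "0 < \<epsilon>"
  shows "\<exists>K>0. \<exists>\<delta>>0. \<exists>n0. \<forall>n\<ge>n0. \<forall>s X Y W. X \<subseteq> {..<n} \<longrightarrow> Y \<subseteq> {..<n} \<longrightarrow> X \<inter> Y = {} \<longrightarrow>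
    card X = s \<longrightarrow> card Y = s \<longrightarrow> \<epsilon> * real n \<le> real s \<longrightarrow> W \<subseteq> vertex_pairs n \<times> UNIV \<longrightarrow>
    real (card (missed_pairs n (X \<union> Y) W)) < \<delta> * (real n)\<^sup>2 \<longrightarrow>
    (\<exists>w. spread W ((real n)\<^sup>2) (real n powr (- 1 / max (m2_density H) 1)) K (card (edges H)) w \<and>
      1 \<le> wdeg W w {} \<and> (\<forall>A. w A \<noteq> 0 \<longrightarrow> A \<in> good_copies H X Y))"
proof -
  obtain M where M: "0 < M" and pat: "\<forall>c :: nat set \<Rightarrow> colour. \<exists>\<psi> col. inj_on \<psi> (verts H) \<and> \<psi> ` verts H \<subseteq> {..<2 * M} \<and>
      (\<forall>e\<in>edges H. c (\<psi> ` e) = col) \<and>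
      (col = Red \<longrightarrow> independence_number H \<le> card {v \<in> verts H. \<psi> v < M}) \<and>
      (col = Blue \<longrightarrow> independence_number H \<le> card {v \<in> verts H. M \<le> \<psi> v})"
    using ramsey_pattern[OF H] by (elim exE conjE)
  define h where "h = card (verts H)"
  define m where "m = max (m2_density H) 1"
  define L where "L = 2 * M"
  have L: "2 \<le> L" using M unfolding L_def by simp
  \<comment> \<open>With this value the missed pairs spoil at most \<open>s ^ L / 8\<close> maps.
    The coincidences spoil at most as many once \<open>16 * L\<^sup>2 \<le> s\<close>, which
    \<open>n0\<close> ensures.\<close>
  define \<delta> where "\<delta> = \<epsilon>\<^sup>2 / (16 * (real L)\<^sup>2)"
  have \<delta>: "0 < \<delta>" using \<epsilon> L unfolding \<delta>_def by simp
  \<comment> \<open>The 2 comes from the normalisation of the weights. Adding 1 makes the base at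
    least 1, so the exponent \<open>u\<close> can be raised to \<open>h\<close>.\<close>
  define K where "K = 2 * (real L / \<epsilon> + 1) ^ h"
  have K: "0 < K" using \<epsilon> L unfolding K_def by (simp add: add_nonneg_pos)
  define n0 where "n0 = max 1 (nat \<lceil>16 * (real L)\<^sup>2 / \<epsilon>\<rceil>)"
  have "\<exists>w. spread W ((real n)\<^sup>2) (real n powr (- 1 / m)) K (card (edges H)) w \<and>
      1 \<le> wdeg W w {} \<and> (\<forall>A. w A \<noteq> 0 \<longrightarrow> A \<in> good_copies H X Y)"
    if n: "n0 \<le> n" and X: "X \<subseteq> {..<n}" "card X = s" and Y: "Y \<subseteq> {..<n}" "card Y = s" and XY: "X \<inter> Y = {}"
      and s: "\<epsilon> * real n \<le> real s" and W: "W \<subseteq> vertex_pairs n \<times> UNIV"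
      and D: "real (card {e \<in> vertex_pairs n. (e, Red) \<notin> W \<and> (e, Blue) \<notin> W \<and> e \<subseteq> X \<union> Y}) < \<delta> * (real n)\<^sup>2"
    for n s X Y W
  proof -
    let ?D = "{e \<in> vertex_pairs n. (e, Red) \<notin> W \<and> (e, Blue) \<notin> W \<and> e \<subseteq> X \<union> Y}"
    have n1: "1 \<le> n" using n unfolding n0_def by simp
    have "16 * (real L)\<^sup>2 / \<epsilon> \<le> real n" using n unfolding n0_def by linarith
    then have "16 * (real L)\<^sup>2 \<le> \<epsilon> * real n" using \<epsilon> by (simp add: pos_divide_le_eq mult.commute)
    then have sL: "16 * (real L)\<^sup>2 \<le> real s" using s by linarith
    then have s0: "0 < real s" using L by (smt (verit) of_nat_0_le_iff power2_less_eq_zero_iff of_nat_le_0_iff numeral_le_iff not_numeral_le_zero)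
    have finX: "finite X" "finite Y" using X Y finite_subset by auto
    have finV: "finite (vertex_pairs n)" unfolding vertex_pairs_def by simp
    have "finite (UNIV :: colour set)"
      by (rule finite_subset[of _ "{Red, Blue}"]) (use colour.exhaust in auto)
    then have finW: "finite W" using W finV by (meson finite_SigmaI finite_subset)
    define I where "I = {..<L}"
    have cI: "card I = L" "finite I" unfolding I_def by auto
    define B where "B = (\<lambda>i. if i < M then X else Y)"
    have B: "\<And>i. i \<in> I \<Longrightarrow> finite (B i) \<and> card (B i) = s" unfolding B_def using X Y finX by simp
    have finP: "finite (PiE I B)" using B cI by (intro finite_PiE) auto
    have cP: "card (PiE I B) = s ^ L" using B cI by (simp add: card_PiE)
    \<comment> \<open>The diagonal excludes coincidences, and the second part excludes missed pairs.
      A map avoiding \<open>R\<close> is therefore injective and sees every pair in some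
      colour.\<close>
    define R where "R = (\<lambda>x. (x, x)) ` (X \<union> Y) \<union> {(x, y). {x, y} \<in> ?D}"
    have D2: "card e = 2" if "e \<in> ?D" for e using that unfolding vertex_pairs_def by simp
    have finD: "finite ?D" using finV by simp
    note pairs = card_pairs_of_edges_le[OF finD D2]
    have finR: "finite R" unfolding R_def using finX pairs(1) by blast
    have "card ((\<lambda>x. (x, x)) ` (X \<union> Y)) \<le> card (X \<union> Y)" using finX by (intro card_image_le) auto
    moreover have "card (X \<union> Y) = 2 * s" using card_Un_disjoint[OF finX XY] X Y by simp
    moreover have "card R \<le> card ((\<lambda>x. (x, x)) ` (X \<union> Y)) + card {(x, y). {x, y} \<in> ?D}"
      unfolding R_def by (rule card_Un_le)
    ultimately have "card R \<le> 2 * s + 2 * card ?D" using pairs(2) by linarith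
    then have "real (card R) \<le> 2 * real s + 2 * real (card ?D)" by linarith
    also have "\<dots> \<le> 2 * real s + 2 * (\<delta> * (real n)\<^sup>2)" using D by linarith
    finally have "(real L)\<^sup>2 * real (card R) \<le> (real L)\<^sup>2 * (2 * real s + 2 * (\<delta> * (real n)\<^sup>2))"
      by (intro mult_left_mono) auto
    also have "\<dots> = (16 * (real L)\<^sup>2) * real s / 8 + (\<epsilon> * real n)\<^sup>2 / 8"
      unfolding \<delta>_def using L by (simp add: field_simps power2_eq_square)
    also have "\<dots> \<le> real s * real s / 8 + (real s)\<^sup>2 / 8"
      using sL s s0 \<epsilon> by (intro add_mono divide_right_mono mult_right_mono power_mono) auto
    also have "\<dots> \<le> (real s)\<^sup>2 / 2" by (simp add: power2_eq_square)
    finally have R: "(real L)\<^sup>2 * real (card R) \<le> (real s)\<^sup>2 / 2" .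
    define Bad where "Bad = {g \<in> PiE I B. \<exists>i\<in>I. \<exists>j\<in>I. i \<noteq> j \<and> (g i, g j) \<in> R}"
    define G where "G = PiE I B - Bad"
    have finG: "finite G" unfolding G_def using finP by simp
    have "card Bad \<le> L\<^sup>2 * card R * s ^ (L - 2)"
      unfolding Bad_def using card_PiE_related_pair_le[OF cI(2) B finR] cI(1) by simp
    then have "real (card Bad) \<le> real (L\<^sup>2 * card R * s ^ (L - 2))" by (simp only: of_nat_le_iff)
    also have "\<dots> = ((real L)\<^sup>2 * real (card R)) * real s ^ (L - 2)" by simp
    also have "\<dots> \<le> (real s)\<^sup>2 / 2 * real s ^ (L - 2)" by (rule mult_right_mono[OF R]) simp
    also have "\<dots> = real s ^ L / 2"
      using L by (metis le_add_diff_inverse power_add times_divide_eq_left)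
    finally have bad: "real (card Bad) \<le> real s ^ L / 2" .
    have "card G = card (PiE I B) - card Bad" unfolding G_def
      by (rule card_Diff_subset) (use finP Bad_def in auto)
    then have "real (card G) \<ge> real s ^ L - real (card Bad)" using cP by (simp add: of_nat_diff_if)
    then have good: "real s ^ L / 2 \<le> real (card G)" using bad by linarith
    have "\<exists>A\<in>good_copies H X Y. A \<subseteq> W \<and> \<Union>(fst ` A) \<subseteq> g ` I" if g: "g \<in> G" for g
      unfolding I_def L_def
    proof (rule good_copy_exists[OF H pat[rule_format]])
      have gP: "g \<in> PiE I B" and gR: "\<And>i j. i \<in> I \<Longrightarrow> j \<in> I \<Longrightarrow> i \<noteq> j \<Longrightarrow> (g i, g j) \<notin> R"
        using g unfolding G_def Bad_def by auto
      show "g \<in> (\<Pi>\<^sub>E i\<in>{..<2 * M}. if i < M then X else Y)" using gP unfolding I_def L_def B_def .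
      have gXY: "g i \<in> X \<union> Y" if "i \<in> I" for i using gP that unfolding B_def by (auto simp: PiE_iff split: if_splits)
      have ne: "g i \<noteq> g j" if "i \<in> I" "j \<in> I" "i \<noteq> j" for i j
        using gR[OF that] gXY[OF that(1)] unfolding R_def by auto
      show "inj_on g {..<2 * M}" using ne unfolding inj_on_def I_def L_def by blast
      fix i j assume ij: "i < 2 * M" "j < 2 * M" "i \<noteq> j"
      then have ijI: "i \<in> I" "j \<in> I" unfolding I_def L_def by auto
      have "{g i, g j} \<in> vertex_pairs n"
        using gXY[OF ijI(1)] gXY[OF ijI(2)] ne[OF ijI ij(3)] X Y unfolding vertex_pairs_def by auto
      moreover have "{g i, g j} \<notin> ?D" using gR[OF ijI ij(3)] unfolding R_def by blast
      moreover have "{g i, g j} \<subseteq> X \<union> Y" using gXY ijI by simp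
      ultimately show "({g i, g j}, Red) \<in> W \<or> ({g i, g j}, Blue) \<in> W" by blast
    qed
    then have "\<forall>g\<in>G. \<exists>A. A \<in> good_copies H X Y \<and> A \<subseteq> W \<and> \<Union>(fst ` A) \<subseteq> g ` I" by blast
    from bchoice[OF this] obtain A where A: "\<And>g. g \<in> G \<Longrightarrow> A g \<in> good_copies H X Y"
      "\<And>g. g \<in> G \<Longrightarrow> A g \<subseteq> W" "\<And>g. g \<in> G \<Longrightarrow> \<Union>(fst ` A g) \<subseteq> g ` I" by blast
    \<comment> \<open>At least half of the \<open>s ^ L\<close> maps are good, so this normalisation
      gives total weight at least 1.\<close>
    define w where "w = (\<lambda>B. 2 / real s ^ L * real (card {g \<in> G. A g = B}))"
    have wdeg: "wdeg W w T = 2 / real s ^ L * real (card {g \<in> G. T \<subseteq> A g})" for T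
      unfolding w_def by (rule wdeg_counting[OF finW finG A(2)])
    have w_ne: "\<exists>g\<in>G. A g = B" if "w B \<noteq> 0" for B
    proof (rule ccontr)
      assume "\<not> (\<exists>g\<in>G. A g = B)"
      then have e: "{g \<in> G. A g = B} = {}" by blast
      show False using that unfolding w_def e by simp
    qed
    have "spread W ((real n)\<^sup>2) (real n powr (- 1 / m)) K (card (edges H)) w"
      unfolding spread_def
    proof (intro conjI allI impI)
      fix B show "0 \<le> w B" unfolding w_def by simp
    next
      fix B assume "w B \<noteq> 0"
      then obtain g where "g \<in> G" "A g = B" using w_ne by blast
      then show "B \<subseteq> W" "card B = card (edges H)"
        using A good_copies_density(1)[OF H] by blast+
    next
      fix T assume T: "T \<subseteq> W" "T \<noteq> {}"
      let ?t = "real n powr (- 1 / m)"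
      show "wdeg W w T \<le> K * ?t ^ (card T - 1) / (real n)\<^sup>2"
      proof (cases "\<exists>g\<in>G. T \<subseteq> A g")
        case False
        then have "{g \<in> G. T \<subseteq> A g} = {}" by blast
        then have "wdeg W w T = 0" unfolding wdeg by (metis card.empty mult_zero_right of_nat_0)
        then show ?thesis using K by simp
      next
        case True
        then obtain g where g: "g \<in> G" "T \<subseteq> A g" by blast
        define U where "U = \<Union>(fst ` T)"
        define u where "u = card U"
        have u: "2 \<le> u" "u \<le> h" "real (card T) - 1 \<le> m * (real u - 2)"
          using good_copies_density(2)[OF H A(1)[OF g(1)] g(2) T(2)]
          unfolding u_def U_def h_def m_def by auto
        have "U \<subseteq> \<Union>(fst ` A g)" unfolding U_def using g(2) by blast
        then have Ug: "U \<subseteq> g ` I" using A(3)[OF g(1)] by blast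
        then have finU: "finite U" using cI finite_subset by blast
        have "u \<le> card (g ` I)" unfolding u_def using Ug cI by (intro card_mono) auto
        also have "\<dots> \<le> L" using card_image_le[OF cI(2), of g] cI(1) by simp
        finally have uL: "u \<le> L" .
        have cT: "1 \<le> card T" using T finW finite_subset by (metis One_nat_def Suc_leI card_gt_0_iff)
        \<comment> \<open>A map selecting a copy that contains \<open>T\<close> must cover all
          vertices of \<open>T\<close>, so the degree is bounded by a count of maps covering
          \<open>U\<close>.\<close>
        have "{g \<in> G. T \<subseteq> A g} \<subseteq> {g \<in> PiE I B. U \<subseteq> g ` I}"
        proof
          fix g' assume "g' \<in> {g \<in> G. T \<subseteq> A g}"
          then have g': "g' \<in> G" "T \<subseteq> A g'" by auto
          then have "U \<subseteq> \<Union>(fst ` A g')" unfolding U_def by blast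
          then have "U \<subseteq> g' ` I" using A(3)[OF g'(1)] by blast
          then show "g' \<in> {g \<in> PiE I B. U \<subseteq> g ` I}" using g'(1) unfolding G_def by blast
        qed
        then have "card {g \<in> G. T \<subseteq> A g} \<le> card {g \<in> PiE I B. U \<subseteq> g ` I}"
          using finP by (intro card_mono) auto
        also have "\<dots> \<le> L ^ u * s ^ (L - u)"
          using card_PiE_image_superset_le[OF cI(2) B finU] cI(1) unfolding u_def by simp
        finally have "real (card {g \<in> G. T \<subseteq> A g}) \<le> real (L ^ u * s ^ (L - u))" by (simp only: of_nat_le_iff)
        also have "\<dots> = real L ^ u * real s ^ (L - u)" by simp
        finally have "wdeg W w T \<le> 2 / real s ^ L * (real L ^ u * real s ^ (L - u))"
          unfolding wdeg using s0 by (intro mult_left_mono) auto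
        also have "\<dots> = 2 * (real L / real s) ^ u"
        proof -
          have "real s ^ L = real s ^ u * real s ^ (L - u)" using uL by (simp add: power_add[symmetric])
          then show ?thesis using s0 by (simp add: power_divide)
        qed
        also have "\<dots> \<le> 2 * (real L / (\<epsilon> * real n)) ^ u"
          using s \<epsilon> n1 L s0 by (intro mult_left_mono power_mono divide_left_mono) auto
        also have "\<dots> = 2 * (real L / \<epsilon>) ^ u * (1 / real n ^ u)" by (simp add: power_divide power_mult_distrib)
        also have "\<dots> \<le> K * (1 / real n ^ u)"
        proof (rule mult_right_mono)
          have "(real L / \<epsilon>) ^ u \<le> (real L / \<epsilon> + 1) ^ u" using \<epsilon> by (intro power_mono) auto
          also have "\<dots> \<le> (real L / \<epsilon> + 1) ^ h" using \<epsilon> u(2) by (intro power_increasing) auto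
          finally show "2 * (real L / \<epsilon>) ^ u \<le> K" unfolding K_def by simp
        qed simp
        also have "\<dots> \<le> K * (?t ^ (card T - 1) / (real n)\<^sup>2)"
          using powr_density_bound[OF n1 u(1) cT _ u(3)] K unfolding m_def by (intro mult_left_mono) auto
        finally show ?thesis by simp
      qed
    qed
    moreover have "1 \<le> wdeg W w {}"
    proof -
      have "0 < real s ^ L" using s0 by simp
      then show ?thesis unfolding wdeg using good by (simp add: field_simps)
    qed
    moreover have "\<forall>B. w B \<noteq> 0 \<longrightarrow> B \<in> good_copies H X Y" using w_ne A(1) by blast
    ultimately show ?thesis by blast
  qed
  then show ?thesis
    unfolding m_def missed_pairs_def using K \<delta> by (intro exI[of _ K] conjI exI[of _ \<delta>] exI[of _ n0] allI impI) 
qed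

section \<open>The union bound\<close>

lemma sum_Pow_power_card:
  fixes y :: "'b :: comm_semiring_1"
  assumes "finite A"
  shows "(\<Sum>S\<in>Pow A. y ^ card S) = (1 + y) ^ card A"
  using assms
proof (induction A)
  case (insert a A)
  have "(\<Sum>S\<in>Pow (insert a A). y ^ card S) = (\<Sum>S\<in>Pow A. y ^ card S) + (\<Sum>S\<in>insert a ` Pow A. y ^ card S)"
    unfolding Pow_insert using insert.hyps by (intro sum.union_disjoint) auto
  also have "(\<Sum>S\<in>insert a ` Pow A. y ^ card S) = (\<Sum>S\<in>Pow A. y ^ card (insert a S))"
    by (rule sum.reindex_cong[of "insert a"]) (use insert.hyps in \<open>auto simp: inj_on_def dest: insert_ident\<close>)
  also have "\<dots> = (\<Sum>S\<in>Pow A. y * y ^ card S)"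
  proof (rule sum.cong[OF refl])
    fix S assume "S \<in> Pow A"
    then have "finite S" "a \<notin> S" using insert.hyps finite_subset by auto
    then show "y ^ card (insert a S) = y * y ^ card S" by simp
  qed
  also have "\<dots> = y * (\<Sum>S\<in>Pow A. y ^ card S)" by (rule sum_distrib_left[symmetric])
  finally show ?case using insert by (simp add: algebra_simps)
qed simp

text \<open>Each term is multiplied by \<open>x powr (card S - q) \<ge> 1\<close>; after that the bound on \<open>card S\<close> can be dropped.\<close>

lemma sum_bounded_card_power_le:
  fixes p x q :: real
  assumes "finite V" "0 \<le> p" "0 < x" "x \<le> 1"
  shows "(\<Sum>S | S \<subseteq> V \<and> real (card S) \<le> q. p ^ card S) \<le> x powr (- q) * exp (p * x * real (card V))"
proof -
  have "(\<Sum>S | S \<subseteq> V \<and> real (card S) \<le> q. p ^ card S)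
      \<le> (\<Sum>S | S \<subseteq> V \<and> real (card S) \<le> q. x powr (- q) * (p * x) ^ card S)"
  proof (rule sum_mono)
    fix S assume "S \<in> {S. S \<subseteq> V \<and> real (card S) \<le> q}"
    then have S: "real (card S) \<le> q" by simp
    have "1 = x powr (- q) * x powr q" using assms by (simp add: powr_add[symmetric])
    also have "\<dots> \<le> x powr (- q) * x powr (real (card S))"
      using S assms by (intro mult_left_mono powr_mono') auto
    also have "\<dots> = x powr (- q) * x ^ card S" using assms by (simp add: powr_realpow)
    finally have "1 * p ^ card S \<le> x powr (- q) * x ^ card S * p ^ card S"
      using assms by (intro mult_right_mono) auto
    then show "p ^ card S \<le> x powr (- q) * (p * x) ^ card S" by (simp add: power_mult_distrib mult_ac)
  qed
  also have "\<dots> \<le> (\<Sum>S\<in>Pow V. x powr (- q) * (p * x) ^ card S)"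
    using assms by (intro sum_mono2) auto
  also have "\<dots> = x powr (- q) * (1 + p * x) ^ card V"
    unfolding sum_distrib_left[symmetric] sum_Pow_power_card[OF assms(1)] ..
  also have "\<dots> \<le> x powr (- q) * exp (p * x) ^ card V"
    using assms by (intro mult_left_mono power_mono exp_ge_add_one_self) auto
  also have "exp (p * x) ^ card V = exp (p * x * real (card V))"
    by (simp add: exp_of_nat_mult[symmetric] mult.commute)
  finally show ?thesis .
qed

section \<open>Coloured pairs and elementary events of the random graph\<close>

lemma UNIV_colour: "UNIV = {Red, Blue}"
  using colour.exhaust by auto

lemma finite_vertex_pairs: "finite (vertex_pairs n)"
  unfolding vertex_pairs_def by simp

lemma card_vertex_pairs_colour_le: "card (vertex_pairs n \<times> (UNIV :: colour set)) \<le> n\<^sup>2"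
proof -
  have "card (vertex_pairs n) = n choose 2"
    unfolding vertex_pairs_def using n_subsets[of "{..<n}" 2] by simp
  moreover have "card (UNIV :: colour set) = 2" unfolding UNIV_colour by simp
  ultimately have "card (vertex_pairs n \<times> (UNIV :: colour set)) = n * (n - 1) div 2 * 2"
    by (simp add: card_cartesian_product choose_two)
  also have "\<dots> \<le> n * (n - 1)" by simp
  also have "\<dots> \<le> n\<^sup>2" by (simp add: power2_eq_square)
  finally show ?thesis .
qed

lemma prob_contains_avoids:
  assumes "S \<subseteq> vertex_pairs n" "D \<subseteq> vertex_pairs n" "S \<inter> D = {}" "0 \<le> p" "p \<le> 1"
  shows "measure_pmf.prob (binomial_random_graph n p) {G. S \<subseteq> edges G \<and> edges G \<inter> D = {}}
    = p ^ card S * (1 - p) ^ card D"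
proof -
  let ?B = "\<lambda>e. if e \<in> S then {True} else if e \<in> D then {False} else UNIV"
  have "measure_pmf.prob (binomial_random_graph n p) {G. S \<subseteq> edges G \<and> edges G \<inter> D = {}}
    = measure_pmf.prob (Pi_pmf (vertex_pairs n) False (\<lambda>_. bernoulli_pmf p)) (Pi (vertex_pairs n) ?B)"
    unfolding binomial_random_graph_def measure_map_pmf
    by (rule arg_cong2[of _ _ _ _ measure]) (use assms in \<open>auto simp: Pi_def\<close>)
  also have "\<dots> = (\<Prod>e\<in>vertex_pairs n. measure_pmf.prob (bernoulli_pmf p) (?B e))"
    by (rule measure_Pi_pmf_Pi[OF finite_vertex_pairs])
  also have "\<dots> = (\<Prod>e\<in>vertex_pairs n. (if e \<in> S then p else 1) * (if e \<in> D then 1 - p else 1))"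
    using assms by (intro prod.cong refl) (auto simp: measure_pmf_single)
  also have "\<dots> = p ^ card S * (1 - p) ^ card D"
    using assms by (simp add: prod.distrib prod.If_cases finite_vertex_pairs Int_absorb1)
  finally show ?thesis .
qed

lemma edges_binomial_random_graph:
  assumes "G \<in> set_pmf (binomial_random_graph n p)"
  shows "verts G = {..<n}" "edges G \<subseteq> vertex_pairs n"
  using assms unfolding binomial_random_graph_def by auto

text \<open>A good copy among the coloured edges of \<open>G\<close> would, after forgetting the
  colours, be one of the monochromatic copies that the failure of richness excludes.\<close>

lemma not_rich_independent:
  assumes H: "simple_graph H" and G: "verts G = {..<n}" and nr: "\<not> rich H s G"
  shows "\<exists>X Y \<phi>. X \<subseteq> {..<n} \<and> Y \<subseteq> {..<n} \<and> X \<inter> Y = {} \<and> card X = s \<and> card Y = s \<and>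
    (\<forall>A\<in>good_copies H X Y. \<not> A \<subseteq> {(e, \<phi> e) | e. e \<in> edges G \<and> e \<subseteq> X \<union> Y})"
proof -
  obtain \<phi> X Y where XY: "X \<subseteq> {..<n}" "Y \<subseteq> {..<n}" "X \<inter> Y = {}" "card X = s" "card Y = s"
    and red': "\<not> (\<exists>H'. is_copy_in H' H (induced_subgraph G (X \<union> Y)) \<and> Defs.monochromatic \<phi> Red H' \<and>
              independence_number H \<le> card (verts H' \<inter> X))"
    and blue': "\<not> (\<exists>H'. is_copy_in H' H (induced_subgraph G (X \<union> Y)) \<and> Defs.monochromatic \<phi> Blue H' \<and>
              independence_number H \<le> card (verts H' \<inter> Y))"
    using nr unfolding rich_def G by (simp only: not_all not_imp de_Morgan_disj) (elim exE conjE)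
  have red: "\<not> independence_number H \<le> card (verts H' \<inter> X)"
    if "is_copy_in H' H (induced_subgraph G (X \<union> Y))" "Defs.monochromatic \<phi> Red H'" for H'
    using red' that by blast
  have blue: "\<not> independence_number H \<le> card (verts H' \<inter> Y)"
    if "is_copy_in H' H (induced_subgraph G (X \<union> Y))" "Defs.monochromatic \<phi> Blue H'" for H'
    using blue' that by blast
  have "\<not> A \<subseteq> {(e, \<phi> e) | e. e \<in> edges G \<and> e \<subseteq> X \<union> Y}" if A: "A \<in> good_copies H X Y" for A
  proof
    assume AI: "A \<subseteq> {(e, \<phi> e) | e. e \<in> edges G \<and> e \<subseteq> X \<union> Y}"
    obtain \<psi> col where \<psi>: "A = (\<lambda>e. (\<psi> ` e, col)) ` edges H" "inj_on \<psi> (verts H)" "\<psi> ` verts H \<subseteq> X \<union> Y"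
      "col = Red \<longrightarrow> independence_number H \<le> card (\<psi> ` verts H \<inter> X)"
      "col = Blue \<longrightarrow> independence_number H \<le> card (\<psi> ` verts H \<inter> Y)"
      using A unfolding good_copies_def by (elim CollectE exE conjE)
    define H' where "H' = (\<psi> ` verts H, (\<lambda>e. \<psi> ` e) ` edges H)"
    have finV: "finite (verts H)" and E: "\<And>e. e \<in> edges H \<Longrightarrow> e \<subseteq> verts H \<and> card e = 2"
      using H unfolding simple_graph_def by auto
    have e: "\<psi> ` e \<in> edges G" "\<psi> ` e \<subseteq> X \<union> Y" "\<phi> (\<psi> ` e) = col" if "e \<in> edges H" for e
    proof -
      have "(\<psi> ` e, col) \<in> A" using that \<psi>(1) by blast
      then show "\<psi> ` e \<in> edges G" "\<psi> ` e \<subseteq> X \<union> Y" "\<phi> (\<psi> ` e) = col" using AI by auto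
    qed
    have c: "card (\<psi> ` e) = 2" if "e \<in> edges H" for e
      using E[OF that] card_image[OF inj_on_subset[OF \<psi>(2)]] by metis
    have s: "simple_graph H'"
      unfolding simple_graph_def H'_def using finV E c by (auto intro: image_mono)
    have "\<psi> ` verts H \<subseteq> {..<n} \<inter> (X \<union> Y)" using \<psi>(3) XY by blast
    moreover have "(\<lambda>e. \<psi> ` e) ` edges H \<subseteq> {e \<in> edges G. e \<subseteq> X \<union> Y}" using e by blast
    ultimately have "subgraph H' (induced_subgraph G (X \<union> Y))"
      using s unfolding subgraph_def induced_subgraph_def H'_def G by simp
    moreover have "graph_isomorphic H H'"
      unfolding graph_isomorphic_def H'_def using \<psi>(2) by (intro exI[of _ \<psi>]) (simp add: bij_betw_def)
    ultimately have copy: "is_copy_in H' H (induced_subgraph G (X \<union> Y))" unfolding is_copy_in_def by blast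
    have mono: "Defs.monochromatic \<phi> col H'" unfolding Defs.monochromatic_def H'_def using e by auto
    show False
      using red[OF copy] blue[OF copy] mono \<psi>(4,5) unfolding H'_def by (cases col) auto
  qed
  then show ?thesis using XY by (intro exI[of _ X] exI[of _ Y] exI[of _ \<phi>]) simp
qed

text \<open>Union bound over fingerprints \<open>S\<close>. The graph must contain the pairs of
  \<open>S\<close> and avoid those missed by the container of \<open>S\<close>. These are disjoint
  sets of pairs, so independence gives the probability. The parameter \<open>x\<close> is left free
  for later optimisation.\<close>

lemma prob_coloured_independent_le:
  fixes \<E> :: "(nat set \<times> colour) set set" and p q d x :: real
  assumes fp: "fingerprinted {I. I \<subseteq> vertex_pairs n \<times> UNIV \<and> (\<forall>A\<in>\<E>. \<not> A \<subseteq> I)} q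
      (\<lambda>I C. I \<subseteq> C \<and> C \<subseteq> vertex_pairs n \<times> UNIV \<and> \<not> real (card (missed_pairs n Z C)) < d)"
    and p: "0 \<le> p" "p \<le> 1" and x: "0 < x" "x \<le> 1"
  shows "measure_pmf.prob (binomial_random_graph n p)
      {G. edges G \<subseteq> vertex_pairs n \<and> (\<exists>\<phi>. \<forall>A\<in>\<E>. \<not> A \<subseteq> {(e, \<phi> e) | e. e \<in> edges G \<and> e \<subseteq> Z})}
    \<le> x powr (- q) * exp (p * x * (real n)\<^sup>2) * exp (- p * d)"
proof -
  let ?V = "vertex_pairs n \<times> (UNIV :: colour set)"
  let ?P = "measure_pmf.prob (binomial_random_graph n p)"
  have "finite (UNIV :: colour set)" unfolding UNIV_colour by simp
  then have finV: "finite ?V" using finite_vertex_pairs by (rule_tac finite_cartesian_product)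
  obtain F C where FC: "\<forall>I\<in>{I. I \<subseteq> ?V \<and> (\<forall>A\<in>\<E>. \<not> A \<subseteq> I)}. F I \<subseteq> I \<and> real (card (F I)) \<le> q \<and>
      (I \<subseteq> C I \<and> C I \<subseteq> ?V \<and> \<not> real (card (missed_pairs n Z (C I))) < d) \<and> determined F C I"
    using fp unfolding fingerprinted_def by (elim exE)
  \<comment> \<open>Each edge has one colour, so forgetting colours is injective on a fingerprint.
    Disjointness from the missed pairs holds for every fingerprint that arises from a graph.\<close>
  define \<S> where "\<S> = {S. S \<subseteq> ?V \<and> real (card S) \<le> q \<and> inj_on fst S \<and> fst ` S \<inter> missed_pairs n Z (C S) = {} \<and> d \<le> real (card (missed_pairs n Z (C S)))}"
  define ev where "ev = (\<lambda>S. {G :: nat graph. fst ` S \<subseteq> edges G \<and> edges G \<inter> missed_pairs n Z (C S) = {}})"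
  have \<S>: "\<S> \<subseteq> {S. S \<subseteq> ?V \<and> real (card S) \<le> q}" unfolding \<S>_def by blast
  have fin: "finite {S. S \<subseteq> ?V \<and> real (card S) \<le> q}" using finV by simp
  have fin\<S>: "finite \<S>" using \<S> fin finite_subset by blast
  have "{G. edges G \<subseteq> vertex_pairs n \<and> (\<exists>\<phi>. \<forall>A\<in>\<E>. \<not> A \<subseteq> {(e, \<phi> e) | e. e \<in> edges G \<and> e \<subseteq> Z})}
    \<subseteq> (\<Union>S\<in>\<S>. ev S)"
  proof
    fix G :: "nat graph"
    assume "G \<in> {G. edges G \<subseteq> vertex_pairs n \<and> (\<exists>\<phi>. \<forall>A\<in>\<E>. \<not> A \<subseteq> {(e, \<phi> e) | e. e \<in> edges G \<and> e \<subseteq> Z})}"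
    then obtain \<phi> where EG: "edges G \<subseteq> vertex_pairs n"
      and ind: "\<forall>A\<in>\<E>. \<not> A \<subseteq> {(e, \<phi> e) | e. e \<in> edges G \<and> e \<subseteq> Z}" by blast
    define I where "I = {(e, \<phi> e) | e. e \<in> edges G \<and> e \<subseteq> Z}"
    have "I \<subseteq> ?V" unfolding I_def using EG by blast
    then have "I \<in> {I. I \<subseteq> ?V \<and> (\<forall>A\<in>\<E>. \<not> A \<subseteq> I)}" using ind unfolding I_def by simp
    from bspec[OF FC this] have S: "F I \<subseteq> I" "real (card (F I)) \<le> q" "I \<subseteq> C I"
      "d \<le> real (card (missed_pairs n Z (C I)))" "determined F C I" by auto
    \<comment> \<open>The container can be computed from the fingerprint alone, so the events are
      indexed by fingerprints.\<close>
    have CS: "C (F I) = C I" by (rule determinedD[OF S(5)]) (use S(1) in auto)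
    have avoid: "edges G \<inter> missed_pairs n Z (C I) = {}"
    proof (rule ccontr)
      assume "edges G \<inter> missed_pairs n Z (C I) \<noteq> {}"
      then obtain e where e: "e \<in> edges G" "e \<in> missed_pairs n Z (C I)" by blast
      then have "(e, \<phi> e) \<in> I" unfolding I_def missed_pairs_def by blast
      then have "(e, \<phi> e) \<in> C I" using S(3) by blast
      then show False using e(2) unfolding missed_pairs_def by (cases "\<phi> e") auto
    qed
    have sub: "fst ` F I \<subseteq> edges G" using S(1) unfolding I_def by auto
    have "inj_on fst I" unfolding I_def inj_on_def by auto
    then have "inj_on fst (F I)" using S(1) inj_on_subset by blast
    then have "F I \<in> \<S>" unfolding \<S>_def mem_Collect_eq CS using S \<open>I \<subseteq> ?V\<close> sub avoid by auto
    moreover have "G \<in> ev (F I)" unfolding ev_def CS using sub avoid by simp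
    ultimately show "G \<in> (\<Union>S\<in>\<S>. ev S)" by (rule UN_I)
  qed
  then have "?P {G. edges G \<subseteq> vertex_pairs n \<and> (\<exists>\<phi>. \<forall>A\<in>\<E>. \<not> A \<subseteq> {(e, \<phi> e) | e. e \<in> edges G \<and> e \<subseteq> Z})}
    \<le> ?P (\<Union>S\<in>\<S>. ev S)" by (intro measure_pmf.finite_measure_mono) auto
  also have "\<dots> \<le> (\<Sum>S\<in>\<S>. ?P (ev S))"
    by (rule measure_pmf.finite_measure_subadditive_finite[OF fin\<S>]) auto
  also have "\<dots> \<le> (\<Sum>S\<in>\<S>. p ^ card S * exp (- p * d))"
  proof (rule sum_mono)
    fix S assume S: "S \<in> \<S>"
    then have "?P (ev S) = p ^ card (fst ` S) * (1 - p) ^ card (missed_pairs n Z (C S))"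
      unfolding ev_def \<S>_def using p by (intro prob_contains_avoids) (auto simp: missed_pairs_def)
    also have "card (fst ` S) = card S" using S unfolding \<S>_def by (intro card_image) blast
    also have "(1 - p) ^ card (missed_pairs n Z (C S)) \<le> exp (- p) ^ card (missed_pairs n Z (C S))"
      using p exp_ge_add_one_self[of "- p"] by (intro power_mono) auto
    also have "\<dots> = exp (- p * real (card (missed_pairs n Z (C S))))" by (simp add: exp_of_nat_mult[symmetric] mult.commute)
    also have "\<dots> \<le> exp (- p * d)" using S p unfolding \<S>_def by (simp add: mult_left_mono)
    finally show "?P (ev S) \<le> p ^ card S * exp (- p * d)" using p by (simp add: mult_left_mono)
  qed
  also have "\<dots> = (\<Sum>S\<in>\<S>. p ^ card S) * exp (- p * d)" by (rule sum_distrib_right[symmetric])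
  also have "\<dots> \<le> (\<Sum>S | S \<subseteq> ?V \<and> real (card S) \<le> q. p ^ card S) * exp (- p * d)"
    using p by (intro mult_right_mono sum_mono2[OF fin \<S>]) auto
  also have "\<dots> \<le> x powr (- q) * exp (p * x * real (card ?V)) * exp (- p * d)"
    by (intro mult_right_mono sum_bounded_card_power_le finV p x) simp
  also have "\<dots> \<le> x powr (- q) * exp (p * x * (real n)\<^sup>2) * exp (- p * d)"
  proof -
    have "real (card ?V) \<le> (real n)\<^sup>2"
      using card_vertex_pairs_colour_le[of n] by (metis of_nat_le_iff of_nat_power)
    then show ?thesis using p x by (intro mult_right_mono mult_left_mono) (auto intro: mult_left_mono)
  qed
  finally show ?thesis .
qed

text \<open>Put \<open>E = p * n\<^sup>2\<close>. Avoiding the missed pairs gains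
  \<open>exp (- \<delta> * E)\<close>, of which the fingerprints use at most half. The at most
  \<open>4 ^ n\<close> choices of \<open>(X, Y)\<close> cost at most \<open>exp (2 * n)\<close>, and
  \<open>8 * n \<le> \<delta> * E\<close>.\<close>

lemma prob_not_rich_le:
  fixes H :: "'a graph" and \<epsilon> :: real
  assumes H: "simple_graph H" and \<epsilon>: "0 < \<epsilon>"
  shows "\<exists>C>0. \<exists>n0. \<forall>n\<ge>n0. \<forall>p. 0 \<le> p \<longrightarrow> p \<le> 1 \<longrightarrow> C * real n powr (- 1 / max (m2_density H) 1) \<le> p \<longrightarrow>
    measure_pmf.prob (binomial_random_graph n p) {G. \<not> rich H (nat \<lceil>\<epsilon> * real n\<rceil>) G} \<le> exp (- real n)"
proof -
  define m where "m = max (m2_density H) 1"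
  have m: "1 \<le> m" unfolding m_def by simp
  obtain K \<delta> n1 where K: "0 < K" and \<delta>: "0 < \<delta>" and sp: "\<forall>n\<ge>n1. \<forall>s X Y W. X \<subseteq> {..<n} \<longrightarrow> Y \<subseteq> {..<n} \<longrightarrow> X \<inter> Y = {} \<longrightarrow>
    card X = s \<longrightarrow> card Y = s \<longrightarrow> \<epsilon> * real n \<le> real s \<longrightarrow> W \<subseteq> vertex_pairs n \<times> UNIV \<longrightarrow>
    real (card (missed_pairs n (X \<union> Y) W)) < \<delta> * (real n)\<^sup>2 \<longrightarrow>
    (\<exists>w. spread W ((real n)\<^sup>2) (real n powr (- 1 / m)) K (card (edges H)) w \<and>
      1 \<le> wdeg W w {} \<and> (\<forall>A. w A \<noteq> 0 \<longrightarrow> A \<in> good_copies H X Y))"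
    using spread_good_copies[OF H \<epsilon>] unfolding m_def by (elim exE conjE)
  obtain A t0 where A: "0 \<le> A" and t0: "0 < t0" and cont: "\<forall>(V :: (nat set \<times> colour) set) N t \<E> L. finite V \<longrightarrow> real (card V) \<le> N \<longrightarrow> 0 < t \<longrightarrow> t \<le> t0 \<longrightarrow>
    1 \<le> N * t \<longrightarrow>
    (\<forall>W\<subseteq>V. L W \<longrightarrow> (\<exists>w. spread W N t K (card (edges H)) w \<and> 1 \<le> wdeg W w {} \<and> (\<forall>A. w A \<noteq> 0 \<longrightarrow> A \<in> \<E>))) \<longrightarrow>
    fingerprinted {I. I \<subseteq> V \<and> (\<forall>A\<in>\<E>. \<not> A \<subseteq> I)} (A * (N * t)) (\<lambda>I C. I \<subseteq> C \<and> C \<subseteq> V \<and> \<not> L C)"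
    using container_iterated[OF K, of "card (edges H)"] by (elim exE conjE)
  \<comment> \<open>Chosen so that the factor \<open>exp (x * E)\<close> uses at most a quarter of
    the exponent \<open>\<delta> * E\<close>.\<close>
  define x where "x = min 1 (\<delta> / 4)"
  have x: "0 < x" "x \<le> 1" "x \<le> \<delta> / 4" unfolding x_def using \<delta> by auto
  \<comment> \<open>The first summand yields \<open>8 * n \<le> \<delta> * E\<close>; the second
    bounds \<open>q * ln (1 / x)\<close> by \<open>\<delta> * E / 4\<close>.\<close>
  define C where "C = 8 / \<delta> + 4 * A * ln (1 / x) / \<delta>"
  have lnx: "0 \<le> ln (1 / x)" using x by simp
  have Cx: "0 \<le> 4 * A * ln (1 / x) / \<delta>" using A lnx \<delta> by simp
  have C: "0 < C" "8 / \<delta> \<le> C" "4 * A * ln (1 / x) / \<delta> \<le> C"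
    unfolding C_def using Cx \<delta> by (auto intro: add_pos_nonneg)
  have "(\<lambda>n. real n powr (- 1 / m)) \<longlonglongrightarrow> 0"
    by (rule tendsto_neg_powr[OF _ filterlim_real_sequentially]) (use m in simp)
  then have "\<forall>\<^sub>F n in sequentially. real n powr (- 1 / m) < t0" using t0 by (rule order_tendstoD)
  then obtain n2 where n2: "\<And>n. n2 \<le> n \<Longrightarrow> real n powr (- 1 / m) < t0"
    unfolding eventually_sequentially by blast
  define n0 where "n0 = max 1 (max n1 n2)"
  have "measure_pmf.prob (binomial_random_graph n p) {G. \<not> rich H (nat \<lceil>\<epsilon> * real n\<rceil>) G} \<le> exp (- real n)"
    if n: "n0 \<le> n" and p: "0 \<le> p" "p \<le> 1" and pC: "C * real n powr (- 1 / m) \<le> p" for n p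
  proof -
    let ?P = "measure_pmf.prob (binomial_random_graph n p)"
    define s where "s = nat \<lceil>\<epsilon> * real n\<rceil>"
    define t where "t = real n powr (- 1 / m)"
    have n': "1 \<le> n" "n1 \<le> n" "n2 \<le> n" using n unfolding n0_def by auto
    have s: "\<epsilon> * real n \<le> real s" unfolding s_def by (rule real_nat_ceiling_ge)
    \<comment> \<open>Here the maximum with 1 in the exponent is used: it makes
      \<open>n\<^sup>2 * t\<close> at least \<open>n\<close>, so the exponential gain can absorb the
      choice of \<open>X\<close> and \<open>Y\<close>.\<close>
    have tn: "1 / real n \<le> t"
    proof -
      have "real n powr (- 1) \<le> real n powr (- 1 / m)" using n' m by (intro powr_mono) auto
      then show ?thesis unfolding t_def using n' by (simp add: powr_minus_divide)
    qed
    then have t: "0 < t" "t \<le> t0" using n2[OF n'(3)] n' unfolding t_def by (auto simp: less_imp_le)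
    have nt: "real n \<le> (real n)\<^sup>2 * t"
    proof -
      have "(real n)\<^sup>2 * (1 / real n) \<le> (real n)\<^sup>2 * t" using tn by (intro mult_left_mono) auto
      then show ?thesis using n' by (simp add: power2_eq_square)
    qed
    define E where "E = p * (real n)\<^sup>2"
    have EC: "C * ((real n)\<^sup>2 * t) \<le> E"
      using mult_right_mono[OF pC, of "(real n)\<^sup>2"] unfolding E_def t_def by (simp add: mult_ac)
    have E0: "0 \<le> E" unfolding E_def using p by simp
    have nE: "8 * real n \<le> \<delta> * E"
    proof -
      have "8 / \<delta> * real n \<le> C * ((real n)\<^sup>2 * t)" using C nt by (intro mult_mono) auto
      then have "8 / \<delta> * real n \<le> E" using EC by linarith
      then show ?thesis using \<delta> by (simp add: pos_divide_le_eq mult.commute)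
    qed
    define q where "q = A * ((real n)\<^sup>2 * t)"
    have qE: "q * ln (1 / x) \<le> \<delta> * E / 4"
    proof -
      have "4 * A * ln (1 / x) / \<delta> * ((real n)\<^sup>2 * t) \<le> C * ((real n)\<^sup>2 * t)"
        using C t by (intro mult_right_mono) auto
      then have "4 * A * ln (1 / x) / \<delta> * ((real n)\<^sup>2 * t) \<le> E" using EC by linarith
      then have "4 * A * ln (1 / x) * ((real n)\<^sup>2 * t) \<le> \<delta> * E" using \<delta> by (simp add: pos_divide_le_eq mult.commute)
      then show ?thesis unfolding q_def by (simp add: mult_ac)
    qed
    define Q where "Q = {(X, Y). X \<subseteq> {..<n} \<and> Y \<subseteq> {..<n} \<and> X \<inter> Y = {} \<and> card X = s \<and> card Y = s}"
    define ev where "ev = (\<lambda>(X, Y). {G :: nat graph. edges G \<subseteq> vertex_pairs n \<and>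
       (\<exists>\<phi>. \<forall>A\<in>good_copies H X Y. \<not> A \<subseteq> {(e, \<phi> e) | e. e \<in> edges G \<and> e \<subseteq> X \<union> Y})})"
    have Qsub: "Q \<subseteq> Pow {..<n} \<times> Pow {..<n}" unfolding Q_def by blast
    then have finQ: "finite Q" by (rule finite_subset) simp
    have "card Q \<le> card (Pow {..<n} \<times> Pow {..<n})" using Qsub by (intro card_mono) auto
    also have "\<dots> = 4 ^ n" by (simp add: card_cartesian_product card_Pow power_mult_distrib[symmetric])
    finally have "real (card Q) \<le> 4 ^ n" by (metis of_nat_le_iff of_nat_numeral of_nat_power)
    also have "(4::real) ^ n \<le> exp 2 ^ n"
    proof (rule power_mono)
      have "2 \<le> exp (1::real)" using exp_ge_add_one_self[of 1] by simp
      then have "2 * 2 \<le> exp 1 * exp (1::real)" by (intro mult_mono) auto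
      then show "4 \<le> exp (2::real)" by (simp add: exp_add[symmetric])
    qed simp
    also have "exp 2 ^ n = exp (2 * real n)" by (simp add: exp_of_nat_mult[symmetric] mult.commute)
    finally have cQ: "real (card Q) \<le> exp (2 * real n)" .
    have ev: "?P (ev z) \<le> exp (- \<delta> * E / 2)" if z: "z \<in> Q" for z
    proof -
      obtain X Y where zXY: "z = (X, Y)" by (cases z)
      then have XY: "X \<subseteq> {..<n}" "Y \<subseteq> {..<n}" "X \<inter> Y = {}" "card X = s" "card Y = s" using z unfolding Q_def by auto
      let ?V = "vertex_pairs n \<times> (UNIV :: colour set)"
      have "finite (UNIV :: colour set)" unfolding UNIV_colour by simp
      then have finV: "finite ?V" using finite_vertex_pairs by (rule_tac finite_cartesian_product)
      have cV: "real (card ?V) \<le> (real n)\<^sup>2"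
        using card_vertex_pairs_colour_le[of n] by (metis of_nat_le_iff of_nat_power)
      have nt1: "1 \<le> (real n)\<^sup>2 * t" using nt n' by linarith
      have large: "\<forall>W\<subseteq>?V. real (card (missed_pairs n (X \<union> Y) W)) < \<delta> * (real n)\<^sup>2 \<longrightarrow>
          (\<exists>w. spread W ((real n)\<^sup>2) t K (card (edges H)) w \<and> 1 \<le> wdeg W w {} \<and> (\<forall>A. w A \<noteq> 0 \<longrightarrow> A \<in> good_copies H X Y))"
        unfolding t_def by (intro allI impI, rule sp[rule_format, OF n'(2) XY s])
      have fp: "fingerprinted {I. I \<subseteq> ?V \<and> (\<forall>A\<in>good_copies H X Y. \<not> A \<subseteq> I)} q
         (\<lambda>I C. I \<subseteq> C \<and> C \<subseteq> ?V \<and> \<not> real (card (missed_pairs n (X \<union> Y) C)) < \<delta> * (real n)\<^sup>2)"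
        unfolding q_def
        using cont[rule_format, OF finV cV t nt1, of "\<lambda>W. real (card (missed_pairs n (X \<union> Y) W)) < \<delta> * (real n)\<^sup>2" "good_copies H X Y"]
          large by simp
      have "?P (ev z) \<le> x powr (- q) * exp (p * x * (real n)\<^sup>2) * exp (- p * (\<delta> * (real n)\<^sup>2))"
        unfolding ev_def zXY prod.case by (rule prob_coloured_independent_le[OF fp p x(1,2)])
      also have "x powr (- q) = exp (q * ln (1 / x))" using x by (simp add: powr_def ln_div)
      also have "exp (q * ln (1 / x)) * exp (p * x * (real n)\<^sup>2) * exp (- p * (\<delta> * (real n)\<^sup>2))
          = exp (q * ln (1 / x) + x * E - \<delta> * E)"
        unfolding E_def by (simp add: exp_add[symmetric] algebra_simps)
      also have "\<dots> \<le> exp (- \<delta> * E / 2)"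
      proof -
        have "x * E \<le> \<delta> / 4 * E" using x E0 by (intro mult_right_mono)
        then show ?thesis using qE by simp
      qed
      finally show ?thesis .
    qed
    have "?P {G. \<not> rich H s G} \<le> ?P (\<Union>z\<in>Q. ev z)"
    \<comment> \<open>The inclusion is shown on the support only, where the vertex set is
      \<open>{..<n}\<close> and all edges are pairs of such vertices.\<close>
    proof (rule measure_pmf.finite_measure_mono_AE)
      show "AE G in measure_pmf (binomial_random_graph n p). G \<in> {G. \<not> rich H s G} \<longrightarrow> G \<in> (\<Union>z\<in>Q. ev z)"
      proof (rule AE_pmfI, rule impI)
        fix G assume G: "G \<in> set_pmf (binomial_random_graph n p)" "G \<in> {G. \<not> rich H s G}"
        note G' = edges_binomial_random_graph[OF G(1)]
        obtain X Y \<phi> where XY: "X \<subseteq> {..<n}" "Y \<subseteq> {..<n}" "X \<inter> Y = {}" "card X = s" "card Y = s"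
          and ind: "\<forall>A\<in>good_copies H X Y. \<not> A \<subseteq> {(e, \<phi> e) | e. e \<in> edges G \<and> e \<subseteq> X \<union> Y}"
          using not_rich_independent[OF H G'(1) CollectD[OF G(2)]] by (elim exE conjE)
        have "(X, Y) \<in> Q" unfolding Q_def using XY by simp
        moreover have "G \<in> ev (X, Y)" unfolding ev_def prod.case
          by (intro CollectI conjI exI[of _ \<phi>] G'(2) ind)
        ultimately show "G \<in> (\<Union>z\<in>Q. ev z)" by (rule UN_I)
      qed
    qed auto
    also have "\<dots> \<le> (\<Sum>z\<in>Q. ?P (ev z))"
      by (rule measure_pmf.finite_measure_subadditive_finite[OF finQ]) auto
    also have "\<dots> \<le> (\<Sum>z\<in>Q. exp (- \<delta> * E / 2))" by (rule sum_mono) (rule ev)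
    also have "\<dots> = real (card Q) * exp (- \<delta> * E / 2)" by simp
    also have "\<dots> \<le> exp (2 * real n) * exp (- \<delta> * E / 2)" by (rule mult_right_mono[OF cQ]) simp
    also have "\<dots> = exp (2 * real n - \<delta> * E / 2)" by (simp add: exp_add[symmetric])
    also have "\<dots> \<le> exp (- real n)" using nE by simp
    finally show ?thesis unfolding s_def .
  qed
  then show ?thesis
    unfolding m_def using C(1) by (intro exI[of _ C] conjI exI[of _ n0] allI impI)
qed

theorem theorem2p7:
  fixes H :: "'a graph"
  assumes "simple_graph H"
  shows "\<forall>\<epsilon>::real. \<epsilon> > 0 \<longrightarrow> (\<exists>C::real. C > 0 \<and> (\<forall>p :: nat \<Rightarrow> real.
           (\<forall>n. 0 \<le> p n \<and> p n \<le> 1) \<and>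
           (\<forall>\<^sub>F n in sequentially. p n \<ge> C * real n powr (- 1 / max (m2_density H) 1)) \<longrightarrow>
           (\<lambda>n. measure_pmf.prob (binomial_random_graph n (p n))
                  {G. rich H (nat \<lceil>\<epsilon> * real n\<rceil>) G}) \<longlonglongrightarrow> 1))"
proof (intro allI impI)
  fix \<epsilon> :: real
  assume "0 < \<epsilon>"
  from prob_not_rich_le[OF assms this] obtain C n0 where C: "0 < C"
    and bound: "\<forall>n\<ge>n0. \<forall>p. 0 \<le> p \<longrightarrow> p \<le> 1 \<longrightarrow> C * real n powr (- 1 / max (m2_density H) 1) \<le> p \<longrightarrow>
      measure_pmf.prob (binomial_random_graph n p) {G. \<not> rich H (nat \<lceil>\<epsilon> * real n\<rceil>) G} \<le> exp (- real n)"
    by (elim exE conjE)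
  show "\<exists>C::real. C > 0 \<and> (\<forall>p :: nat \<Rightarrow> real.
           (\<forall>n. 0 \<le> p n \<and> p n \<le> 1) \<and>
           (\<forall>\<^sub>F n in sequentially. p n \<ge> C * real n powr (- 1 / max (m2_density H) 1)) \<longrightarrow>
           (\<lambda>n. measure_pmf.prob (binomial_random_graph n (p n))
                  {G. rich H (nat \<lceil>\<epsilon> * real n\<rceil>) G}) \<longlonglongrightarrow> 1)"
  proof (intro exI[of _ C] conjI C allI impI)
    fix p :: "nat \<Rightarrow> real"
    assume p: "(\<forall>n. 0 \<le> p n \<and> p n \<le> 1) \<and>
           (\<forall>\<^sub>F n in sequentially. p n \<ge> C * real n powr (- 1 / max (m2_density H) 1))"
    let ?P = "\<lambda>n. measure_pmf.prob (binomial_random_graph n (p n)) {G. rich H (nat \<lceil>\<epsilon> * real n\<rceil>) G}"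
    have "\<forall>\<^sub>F n in sequentially. C * real n powr (- 1 / max (m2_density H) 1) \<le> p n \<and> n0 \<le> n"
      using p eventually_ge_at_top[of n0] by (intro eventually_conj) auto
    then have low: "\<forall>\<^sub>F n in sequentially. 1 - exp (- real n) \<le> ?P n"
    proof eventually_elim
      case (elim n)
      have "measure_pmf.prob (binomial_random_graph n (p n)) {G. \<not> rich H (nat \<lceil>\<epsilon> * real n\<rceil>) G} \<le> exp (- real n)"
        using bound elim p by simp
      moreover have "measure_pmf.prob (binomial_random_graph n (p n)) {G. \<not> rich H (nat \<lceil>\<epsilon> * real n\<rceil>) G} = 1 - ?P n"
        using measure_pmf.prob_compl[of "{G. rich H (nat \<lceil>\<epsilon> * real n\<rceil>) G}" "binomial_random_graph n (p n)"]
        by (simp add: Compl_eq_Diff_UNIV[symmetric] Collect_neg_eq)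
      ultimately show ?case by linarith
    qed
    have "(\<lambda>n. exp (- real n)) \<longlonglongrightarrow> 0"
      by (intro filterlim_compose[OF exp_at_bot] filterlim_compose[OF filterlim_uminus_at_bot_at_top] filterlim_real_sequentially)
    then have "(\<lambda>n. 1 - exp (- real n)) \<longlonglongrightarrow> 1 - 0" by (intro tendsto_diff tendsto_const)
    then have lim: "(\<lambda>n. 1 - exp (- real n)) \<longlonglongrightarrow> 1" by simp
    show "?P \<longlonglongrightarrow> 1"
      by (rule tendsto_sandwich[OF low _ lim tendsto_const]) simp
  qed
qed

end
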